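(* Let $R=\mathbb{R}$ or $\mathbb{C}$, and let $(Z,a)$ be an algebra of the natural distribution monad $\mathbb{D}$ on the category of convergence spaces. Let $X,Y$ be convergence spaces, let $f:X\times Y\to Z$ be a continuous map, and let $\mu:[X,R]\to R$ and $\nu:[Y,R]\to R$ be continuous linear functionals. Then $$\int_y\int_x f(x,y)\,d\mu\,d\nu=\int f\,d(\mu\otimes\nu)=\int_x\int_y f(x,y)\,d\nu\,d\mu.$$
   Context: A convergence space is a set $X$ together with an assignment to each point $x\in X$ of a set of proper filters on $X$, said to converge to $x$, such that: (i) the principal ultrafilter of $x$ converges to $x$; (ii) if $\mathfrak{x}$ converges to $x$ and $\mathfrak{x}\subseteq\mathfrak{y}$ then $\mathfrak{y}$ converges to $x$; (iii) if $\mathfrak{x},\mathfrak{y}$ converge to $x$ then so does $\mathfrak{x}\cap\mathfrak{y}$. A map is continuous if image filters of filters converging to $x$ converge to $f(x)$. $R$ carries its usual topological convergence. A filter converges to $(x,y)$ in $X\times Y$ iff its projections converge to $x$ and $y$. The category of convergence spaces is cartesian closed, the internal hom being the set of continuous maps $X\to Y$ with continuous convergence: a filter $\mathfrak{f}$ converges to $f$ iff whenever $\mathfrak{x}$ converges to $x$ in $X$, the image under evaluation of the product filter generated by $\{A\times B\mid A\in\mathfrak{f},B\in\mathfrak{x}\}$ converges to $f(x)$. $[X,R]$ is the convergence vector space of continuous maps $X\to R$ with pointwise operations and continuous convergence. $DX$ is the set of continuous linear functionals $\mu:[X,R]\to R$, with the convergence structure of continuous convergence (as a subspace of the internal hom of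 continuous maps $[X,R]\to R$). The natural distribution monad $\mathbb{D}=(D,\delta,\kappa)$ is given by: $(Dg)(\mu)(h)=\mu(h\cdot g)$ for continuous $g:X\to Y$, $\mu\in DX$, $h\in[Y,R]$; $\delta_X(x)(h)=h(x)$; and $\kappa_X(\Phi)(h)=\Phi(\mathrm{ev}_h)$ for $\Phi\in DDX$, $h\in[X,R]$, where $\mathrm{ev}_h:DX\to R$, $\mathrm{ev}_h(\mu)=\mu(h)$. Integral. For a $\mathbb{D}$-algebra $(Z,a)$ (so $a:DZ\to Z$ is continuous with the usual algebra axioms), a continuous $g:X\to Z$ and $\mu\in DX$, put $\int_x g(x)\,d\mu:=\int g\,d\mu:=a((Dg)(\mu))\in Z$. For continuous $f:X\times Y\to Z$, the maps $y\mapsto\int_x f(x,y)\,d\mu$ and $x\mapsto\int_y f(x,y)\,d\nu$ are continuous, so iterated integrals make sense. $\mu\otimes\nu\in D(X\times Y)$ is the continuous linear functional given by $(\mu\otimes\nu)(h)=\nu\bigl(y\mapsto\mu(x\mapsto h(x,y))\bigr)$ for $h\in[X\times Y,R]$. *)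

theory Defs
  imports Complex_Main "HOL-Library.FuncSet"
begin

text \<open>
  Convergence spaces live on a carrier set \<open>points X\<close> of a type. A filter on the carrier is a
  filter on the type lying below \<open>principal (points X)\<close>. Recall that the order on
  \<^typ>\<open>'a filter\<close> is the reverse of inclusion of filters as families of sets: a family
  inclusion of F in G reads \<open>G \<le> F\<close>, the intersection of F and G is \<open>sup F G\<close>, and the
  improper filter is \<open>bot\<close>.
\<close>

record 'a conv_space =
  points :: "'a set"
  converges :: "'a filter \<Rightarrow> 'a \<Rightarrow> bool"

locale convergence_space =
  fixes X :: "'a conv_space"
  assumes converges_point: "converges X F x \<Longrightarrow> x \<in> points X"
    and converges_on: "converges X F x \<Longrightarrow> F \<le> principal (points X)"
    and converges_proper: "converges X F x \<Longrightarrow> F \<noteq> bot"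
    and converges_principal: "x \<in> points X \<Longrightarrow> converges X (principal {x}) x"
    and converges_finer: "converges X F x \<Longrightarrow> G \<le> F \<Longrightarrow> G \<noteq> bot \<Longrightarrow> converges X G x"
    and converges_sup: "converges X F x \<Longrightarrow> converges X G x \<Longrightarrow> converges X (sup F G) x"

text \<open>Only the values of \<open>f\<close> on \<open>points X\<close> matter.\<close>

definition conv_continuous :: "'a conv_space \<Rightarrow> 'b conv_space \<Rightarrow> ('a \<Rightarrow> 'b) \<Rightarrow> bool" where
  "conv_continuous X Y f \<longleftrightarrow>
     f \<in> points X \<rightarrow> points Y \<and>
     (\<forall>F x. converges X F x \<longrightarrow> converges Y (filtermap f F) (f x))"

definition top_conv :: "'a::topological_space conv_space" where
  "top_conv = \<lparr>points = UNIV, converges = (\<lambda>F x. F \<noteq> bot \<and> F \<le> nhds x)\<rparr>"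

definition prod_conv :: "'a conv_space \<Rightarrow> 'b conv_space \<Rightarrow> ('a \<times> 'b) conv_space" where
  "prod_conv X Y =
     \<lparr>points = points X \<times> points Y,
      converges = (\<lambda>F p. converges X (filtermap fst F) (fst p) \<and>
                         converges Y (filtermap snd F) (snd p))\<rparr>"

definition sub_conv :: "'a conv_space \<Rightarrow> 'a set \<Rightarrow> 'a conv_space" where
  "sub_conv X S =
     \<lparr>points = points X \<inter> S,
      converges = (\<lambda>F x. converges X F x \<and> x \<in> S \<and> F \<le> principal S)\<rparr>"

text \<open>
  Continuous convergence. Maps are represented extensionally (\<^const>\<open>undefined\<close> off the carrier),
  so that equality of elements is equality of maps on the carrier. Properness of the filter is
  automatic except when \<open>X\<close> is empty.
\<close>

definition hom_conv :: "'a conv_space \<Rightarrow> 'b conv_space \<Rightarrow> ('a \<Rightarrow> 'b) conv_space" where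
  "hom_conv X Y =
     (let H = {f \<in> points X \<rightarrow>\<^sub>E points Y. conv_continuous X Y f} in
      \<lparr>points = H,
       converges = (\<lambda>\<FF> f. f \<in> H \<and> \<FF> \<le> principal H \<and> \<FF> \<noteq> bot \<and>
         (\<forall>F x. converges X F x \<longrightarrow>
            converges Y (filtermap (\<lambda>(g, u). g u) (prod_filter \<FF> F)) (f x)))\<rparr>)"

text \<open>Continuous scalar functions; the scalars are the type \<open>'r\<close>.\<close>

definition cfun :: "'a conv_space \<Rightarrow> ('a \<Rightarrow> 'r::real_normed_field) conv_space" where
  "cfun X = hom_conv X top_conv"

definition linear_functional ::
    "'a conv_space \<Rightarrow> (('a \<Rightarrow> 'r::real_normed_field) \<Rightarrow> 'r) \<Rightarrow> bool" where
  "linear_functional X \<mu> \<longleftrightarrow>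
     (\<forall>g\<in>points (cfun X). \<forall>h\<in>points (cfun X). \<mu> (\<lambda>x\<in>points X. g x + h x) = \<mu> g + \<mu> h) \<and>
     (\<forall>c. \<forall>h\<in>points (cfun X). \<mu> (\<lambda>x\<in>points X. c * h x) = c * \<mu> h)"

definition D :: "'a conv_space \<Rightarrow> (('a \<Rightarrow> 'r::real_normed_field) \<Rightarrow> 'r) conv_space" where
  "D X = sub_conv (hom_conv (cfun X) top_conv) {\<mu>. linear_functional X \<mu>}"

definition D_map :: "'a conv_space \<Rightarrow> 'b conv_space \<Rightarrow> ('a \<Rightarrow> 'b) \<Rightarrow>
    (('a \<Rightarrow> 'r::real_normed_field) \<Rightarrow> 'r) \<Rightarrow> (('b \<Rightarrow> 'r) \<Rightarrow> 'r)" where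
  "D_map X Y g \<mu> = (\<lambda>h\<in>points (cfun Y). \<mu> (compose (points X) h g))"

definition D_unit :: "'a conv_space \<Rightarrow> 'a \<Rightarrow> (('a \<Rightarrow> 'r::real_normed_field) \<Rightarrow> 'r)" where
  "D_unit X x = (\<lambda>h\<in>points (cfun X). h x)"

definition D_mult :: "'a conv_space \<Rightarrow>
    (((('a \<Rightarrow> 'r::real_normed_field) \<Rightarrow> 'r) \<Rightarrow> 'r) \<Rightarrow> 'r) \<Rightarrow> (('a \<Rightarrow> 'r) \<Rightarrow> 'r)" where
  "D_mult X \<Phi> = (\<lambda>h\<in>points (cfun X). \<Phi> (\<lambda>\<mu>\<in>points (D X). \<mu> h))"

locale D_algebra = convergence_space Z
  for Z :: "'z conv_space" +
  fixes a :: "(('z \<Rightarrow> 'r::real_normed_field) \<Rightarrow> 'r) \<Rightarrow> 'z"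
  assumes continuous_structure: "conv_continuous (D Z) Z a"
    and structure_unit: "z \<in> points Z \<Longrightarrow> a (D_unit Z z) = z"
    and structure_mult: "\<Phi> \<in> points (D (D Z)) \<Longrightarrow> a (D_map (D Z) Z a \<Phi>) = a (D_mult Z \<Phi>)"

definition D_integral :: "'z conv_space \<Rightarrow> ((('z \<Rightarrow> 'r::real_normed_field) \<Rightarrow> 'r) \<Rightarrow> 'z) \<Rightarrow>
    'a conv_space \<Rightarrow> ('a \<Rightarrow> 'z) \<Rightarrow> (('a \<Rightarrow> 'r) \<Rightarrow> 'r) \<Rightarrow> 'z" where
  "D_integral Z a X g \<mu> = a (D_map X Z g \<mu>)"

definition D_tensor :: "'a conv_space \<Rightarrow> 'b conv_space \<Rightarrow>
    (('a \<Rightarrow> 'r::real_normed_field) \<Rightarrow> 'r) \<Rightarrow> (('b \<Rightarrow> 'r) \<Rightarrow> 'r) \<Rightarrow> (('a \<times> 'b \<Rightarrow> 'r) \<Rightarrow> 'r)" where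
  "D_tensor X Y \<mu> \<nu> =
     (\<lambda>h\<in>points (cfun (prod_conv X Y)). \<nu> (\<lambda>y\<in>points Y. \<mu> (\<lambda>x\<in>points X. h (x, y))))"

end

theory Submission
  imports Defs
begin

text \<open>
  Since \<open>\<integral> (\<integral> f(x,y) d\<mu>) d\<nu>\<close> is the structure map applied to the algebra multiplication of the
  image of \<open>\<nu>\<close> under \<open>y \<mapsto> D(f(-,y))(\<mu>)\<close>, the associativity law of the algebra rewrites it as the
  structure map applied to \<open>h \<mapsto> \<nu>(y \<mapsto> \<mu>(x \<mapsto> h(f(x,y))))\<close>. Everything therefore reduces to
  Fubini's theorem for scalar functions \<open>h\<close> on \<open>X \<times> Y\<close>.

  Continuity of \<open>\<mu>\<close> means two things: \<open>\<mu>\<close> is bounded on bounded functions, and whenever every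
  convergent filter contains a member of a family of sets, \<open>\<mu>\<close> lives on a finite union of members. In place of the
  supremum over the support of \<open>\<nu>\<close> in a compactification one uses the essential norm, the least
  \<open>c\<close> such that \<open>\<nu>\<close> lives on \<open>{|g| \<le> c}\<close>. The essential norm of \<open>h(x,-) - h(x',-)\<close> is continuous in
  \<open>x\<close>, so finitely many sections \<open>h(j,-)\<close> and a partition of unity on a set carrying \<open>\<mu>\<close> give a tensor
  \<open>\<Sum> \<phi>\<^sub>j(x) h(j,y)\<close> that is essentially close to \<open>h(x,-)\<close> for \<open>\<mu>\<close>-almost all \<open>x\<close>. Both
  iterated integrals agree on tensors, and both are small on the remainder.
\<close>

section \<open>Convergence spaces of functions\<close>

lemma conv_continuous_converges:
  "conv_continuous X Y f \<Longrightarrow> converges X F x \<Longrightarrow> converges Y (filtermap f F) (f x)"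
  by (simp add: conv_continuous_def)

lemma conv_continuous_top_iff:
  fixes f :: "'a \<Rightarrow> 'b::topological_space"
  assumes "convergence_space X"
  shows "conv_continuous X top_conv f \<longleftrightarrow> (\<forall>F x. converges X F x \<longrightarrow> (f \<longlongrightarrow> f x) F)"
  using convergence_space.converges_proper[OF assms]
  by (auto simp: conv_continuous_def top_conv_def filterlim_def filtermap_bot_iff)

lemma conv_continuous_tendsto:
  fixes f :: "'a \<Rightarrow> 'b::topological_space"
  shows "conv_continuous X top_conv f \<Longrightarrow> converges X F x \<Longrightarrow> (f \<longlongrightarrow> f x) F"
  by (auto simp: conv_continuous_def top_conv_def filterlim_def)

lemma eventually_in_points:
  "convergence_space X \<Longrightarrow> converges X F x \<Longrightarrow> eventually (\<lambda>u. u \<in> points X) F"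
  by (metis convergence_space.converges_on le_principal)

lemma conv_continuous_cong:
  assumes "convergence_space X" and eq: "\<And>x. x \<in> points X \<Longrightarrow> f x = g x"
  shows "conv_continuous X Y f \<longleftrightarrow> conv_continuous X Y g"
proof -
  have "filtermap f F = filtermap g F" if "converges X F x" for F x
    unfolding filter_eq_iff eventually_filtermap
    using eventually_in_points[OF assms(1) that]
    by (auto elim: eventually_elim2 simp: eq)
  moreover have "f x = g x" if "converges X F x" for F x
    using convergence_space.converges_point[OF assms(1) that] eq by simp
  ultimately show ?thesis
    using eq by (auto simp: conv_continuous_def Pi_iff)
qed

lemma conv_continuous_compose:
  "conv_continuous X Y f \<Longrightarrow> conv_continuous Y Z g \<Longrightarrow> conv_continuous X Z (\<lambda>x. g (f x))"
  unfolding conv_continuous_def Pi_iff by (simp flip: filtermap_filtermap)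

lemma points_cfun_iff:
  "f \<in> points (cfun X) \<longleftrightarrow> f \<in> extensional (points X) \<and> conv_continuous X top_conv f"
  by (auto simp: cfun_def hom_conv_def Let_def PiE_def top_conv_def)

lemma restrict_in_cfun:
  assumes "convergence_space X" "conv_continuous X top_conv f"
  shows "restrict f (points X) \<in> points (cfun X)"
  using assms(2) conv_continuous_cong[OF assms(1), of "restrict f (points X)" f]
  by (simp add: points_cfun_iff)

lemma converges_cfun_iff:
  assumes "convergence_space X"
  shows "converges (cfun X) \<FF> f \<longleftrightarrow>
    f \<in> points (cfun X) \<and> \<FF> \<le> principal (points (cfun X)) \<and> \<FF> \<noteq> bot \<and>
    (\<forall>F x. converges X F x \<longrightarrow> ((\<lambda>(g, u). g u) \<longlongrightarrow> f x) (\<FF> \<times>\<^sub>F F))"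
proof -
  have "converges top_conv (filtermap (\<lambda>(g, u). g u) (\<FF> \<times>\<^sub>F F)) (f x) \<longleftrightarrow>
      ((\<lambda>(g, u). g u) \<longlongrightarrow> f x) (\<FF> \<times>\<^sub>F F)"
    if "converges X F x" "\<FF> \<noteq> bot" for F x
    using that convergence_space.converges_proper[OF assms, of F x]
    by (simp add: top_conv_def filterlim_def filtermap_bot_iff prod_filter_eq_bot)
  then show ?thesis
    by (auto simp: cfun_def hom_conv_def Let_def)
qed

lemma prod_filter_sup_le: "sup F G \<times>\<^sub>F H \<le> sup (F \<times>\<^sub>F H) (G \<times>\<^sub>F H)"
proof (rule filter_leI)
  fix P assume "eventually P (sup (F \<times>\<^sub>F H) (G \<times>\<^sub>F H))"
  then obtain A B A' B' where "eventually A F" "eventually B H" "eventually A' G" "eventually B' H"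
    and "\<And>x y. A x \<Longrightarrow> B y \<Longrightarrow> P (x, y)" "\<And>x y. A' x \<Longrightarrow> B' y \<Longrightarrow> P (x, y)"
    unfolding eventually_sup eventually_prod_filter by blast
  then show "eventually P (sup F G \<times>\<^sub>F H)"
    unfolding eventually_prod_filter eventually_sup
    by (intro exI[of _ "\<lambda>x. A x \<or> A' x"] exI[of _ "\<lambda>y. B y \<and> B' y"])
       (auto elim: eventually_mono intro: eventually_conj)
qed

lemma convergence_space_cfun:
  assumes X: "convergence_space X"
  shows "convergence_space (cfun X :: ('a \<Rightarrow> 'r::real_normed_field) conv_space)"
proof
  fix \<FF> \<GG> :: "('a \<Rightarrow> 'r) filter" and f
  note iff = converges_cfun_iff[OF X]
  show "f \<in> points (cfun X)" "\<FF> \<le> principal (points (cfun X))" "\<FF> \<noteq> bot" if "converges (cfun X) \<FF> f"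
    using that by (auto simp: iff)
  show "converges (cfun X) (principal {f}) f" if "f \<in> points (cfun X)"
    using that conv_continuous_tendsto[of X f]
    by (auto simp: iff points_cfun_iff prod_filter_principal_singleton filterlim_def
        filtermap_filtermap principal_eq_bot_iff)
  show "converges (cfun X) \<GG> f" if "converges (cfun X) \<FF> f" "\<GG> \<le> \<FF>" "\<GG> \<noteq> bot"
    using that unfolding iff
    by (meson order_trans filterlim_mono order_refl prod_filter_mono)
  show "converges (cfun X) (sup \<FF> \<GG>) f" if "converges (cfun X) \<FF> f" "converges (cfun X) \<GG> f"
    using that unfolding iff
    by (auto simp: sup_eq_bot_iff intro!: filterlim_mono[OF filterlim_sup order_refl prod_filter_sup_le])
qed

lemma convergence_space_prod_conv:
  assumes X: "convergence_space X" and Y: "convergence_space Y"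
  shows "convergence_space (prod_conv X Y)"
proof
  fix F G :: "('a \<times> 'b) filter" and p
  note X' = convergence_space.converges_point[OF X] convergence_space.converges_on[OF X]
    convergence_space.converges_proper[OF X] convergence_space.converges_principal[OF X]
    convergence_space.converges_finer[OF X] convergence_space.converges_sup[OF X]
  note Y' = convergence_space.converges_point[OF Y] convergence_space.converges_on[OF Y]
    convergence_space.converges_proper[OF Y] convergence_space.converges_principal[OF Y]
    convergence_space.converges_finer[OF Y] convergence_space.converges_sup[OF Y]
  show "p \<in> points (prod_conv X Y)" if "converges (prod_conv X Y) F p"
    using that X'(1) Y'(1) by (cases p) (auto simp: prod_conv_def)
  show "F \<le> principal (points (prod_conv X Y))" if "converges (prod_conv X Y) F p"
  proof -
    have "filtermap fst F \<le> principal (points X)" "filtermap snd F \<le> principal (points Y)"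
      using that X'(2) Y'(2) by (auto simp: prod_conv_def)
    then have "F \<le> principal (points X) \<times>\<^sub>F principal (points Y)"
      by (rule le_prod_filterI)
    then show ?thesis
      by (simp add: prod_conv_def principal_prod_principal)
  qed
  show "F \<noteq> bot" if "converges (prod_conv X Y) F p"
    using that X'(3)[of bot] by (auto simp: prod_conv_def)
  show "converges (prod_conv X Y) (principal {p}) p" if "p \<in> points (prod_conv X Y)"
    using that X'(4) Y'(4) by (auto simp: prod_conv_def)
  show "converges (prod_conv X Y) G p" if "converges (prod_conv X Y) F p" "G \<le> F" "G \<noteq> bot"
    using that by (auto simp: prod_conv_def filtermap_bot_iff intro: X'(5) Y'(5) filtermap_mono)
  show "converges (prod_conv X Y) (sup F G) p"
    if "converges (prod_conv X Y) F p" "converges (prod_conv X Y) G p"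
    using that X'(6) Y'(6) by (auto simp: prod_conv_def filtermap_sup)
qed

lemma converges_prod_filter:
  assumes X: "convergence_space X" and Y: "convergence_space Y"
    and F: "converges X F x" and G: "converges Y G y"
  shows "converges (prod_conv X Y) (F \<times>\<^sub>F G) (x, y)"
proof -
  have "F \<times>\<^sub>F G \<noteq> bot"
    using convergence_space.converges_proper[OF X F] convergence_space.converges_proper[OF Y G]
    by (simp add: prod_filter_eq_bot)
  then have "converges X (filtermap fst (F \<times>\<^sub>F G)) x" "converges Y (filtermap snd (F \<times>\<^sub>F G)) y"
    using convergence_space.converges_finer[OF X F filtermap_fst_prod_filter]
      convergence_space.converges_finer[OF Y G filtermap_snd_prod_filter]
    by (auto simp: filtermap_bot_iff)
  then show ?thesis
    by (simp add: prod_conv_def)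
qed

lemma conv_continuous_prod_swap:
  assumes "conv_continuous (prod_conv X Y) Z f"
  shows "conv_continuous (prod_conv Y X) Z (\<lambda>(y, x). f (x, y))"
proof -
  have "converges Z (filtermap (\<lambda>(y, x). f (x, y)) F) (f (snd p, fst p))"
    if "converges X (filtermap snd F) (snd p)" "converges Y (filtermap fst F) (fst p)" for F p
  proof -
    have "converges (prod_conv X Y) (filtermap prod.swap F) (prod.swap p)"
      using that by (simp add: prod_conv_def filtermap_filtermap)
    then have "converges Z (filtermap f (filtermap prod.swap F)) (f (prod.swap p))"
      by (rule conv_continuous_converges[OF assms])
    then show ?thesis
      by (simp add: filtermap_filtermap case_prod_unfold prod.swap_def)
  qed
  then show ?thesis
    using assms by (auto simp: conv_continuous_def prod_conv_def)
qed

lemma conv_continuous_Pair: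
  assumes "conv_continuous (prod_conv X Y) Z f" "convergence_space X" "convergence_space Y"
    "x \<in> points X"
  shows "conv_continuous Y Z (\<lambda>y. f (x, y))"
  unfolding conv_continuous_def
proof (intro conjI allI impI)
  show "(\<lambda>y. f (x, y)) \<in> points Y \<rightarrow> points Z"
    using assms(1,4) by (auto simp: conv_continuous_def prod_conv_def)
  fix F y assume "converges Y F y"
  then have "converges (prod_conv X Y) (principal {x} \<times>\<^sub>F F) (x, y)"
    using assms by (intro converges_prod_filter convergence_space.converges_principal)
  then have "converges (prod_conv X Y) (filtermap (Pair x) F) (x, y)"
    by (simp add: prod_filter_principal_singleton)
  then show "converges Z (filtermap (\<lambda>y. f (x, y)) F) (f (x, y))"
    using conv_continuous_converges[OF assms(1), of "filtermap (Pair x) F" "(x, y)"]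
    by (simp add: filtermap_filtermap)
qed

lemma tendsto_cfun_apply:
  assumes "convergence_space X" "converges (cfun X) (filtermap p F) h" "converges X (filtermap q F) x"
  shows "((\<lambda>z. p z (q z)) \<longlongrightarrow> h x) F"
proof -
  have "((\<lambda>(g, u). g u) \<longlongrightarrow> h x) (filtermap p F \<times>\<^sub>F filtermap q F)"
    using assms by (simp add: converges_cfun_iff)
  moreover have "filterlim (\<lambda>z. (p z, q z)) (filtermap p F \<times>\<^sub>F filtermap q F) F"
    by (simp add: filterlim_def filtermap_Pair)
  ultimately show ?thesis
    by (drule_tac filterlim_compose) auto
qed

lemma conv_continuous_curry:
  assumes X: "convergence_space X" and Y: "convergence_space Y"
    and h: "conv_continuous (prod_conv X Y) top_conv h"
  shows "conv_continuous X (cfun Y) (\<lambda>x. \<lambda>y\<in>points Y. h (x, y))"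
  unfolding conv_continuous_def
proof (intro conjI allI impI)
  let ?c = "\<lambda>x. \<lambda>y\<in>points Y. h (x, y)"
  have c: "?c x \<in> points (cfun Y)" if "x \<in> points X" for x
    by (intro restrict_in_cfun Y conv_continuous_Pair[OF h X Y that])
  then show "?c \<in> points X \<rightarrow> points (cfun Y)" by blast
  fix F x assume F: "converges X F x"
  note FX = eventually_in_points[OF X F]
  show "converges (cfun Y) (filtermap ?c F) (?c x)"
    unfolding converges_cfun_iff[OF Y]
  proof (intro conjI allI impI)
    show "?c x \<in> points (cfun Y)"
      using c F X by (auto intro: convergence_space.converges_point)
    show "filtermap ?c F \<le> principal (points (cfun Y))"
      unfolding le_principal eventually_filtermap using FX by (rule eventually_mono) (rule c)
    show "filtermap ?c F \<noteq> bot"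
      using convergence_space.converges_proper[OF X F] by (simp add: filtermap_bot_iff)
    fix G y assume G: "converges Y G y"
    have "(h \<longlongrightarrow> h (x, y)) (F \<times>\<^sub>F G)"
      by (intro conv_continuous_tendsto[OF h] converges_prod_filter X Y F G)
    moreover have "eventually (\<lambda>p. snd p \<in> points Y) (F \<times>\<^sub>F G)"
      using eventually_prodI[of "\<lambda>_. True" F, OF _ eventually_in_points[OF Y G]] by simp
    then have "eventually (\<lambda>p. h p = ?c (fst p) (snd p)) (F \<times>\<^sub>F G)"
      by (rule eventually_mono) auto
    ultimately have "((\<lambda>p. ?c (fst p) (snd p)) \<longlongrightarrow> h (x, y)) (F \<times>\<^sub>F G)"
      by (rule Lim_transform_eventually)
    then show "((\<lambda>(g, u). g u) \<longlongrightarrow> ?c x y) (filtermap ?c F \<times>\<^sub>F G)"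
      using convergence_space.converges_point[OF Y G]
      by (simp add: prod_filtermap1 filterlim_filtermap case_prod_unfold)
  qed
qed

section \<open>Functionals and iterated integrals\<close>

lemma points_D_iff: "\<mu> \<in> points (D X) \<longleftrightarrow> \<mu> \<in> points (cfun (cfun X)) \<and> linear_functional X \<mu>"
  by (auto simp: D_def sub_conv_def cfun_def)

lemma convergence_space_D:
  assumes "convergence_space X"
  shows "convergence_space (D X :: (('a \<Rightarrow> 'r::real_normed_field) \<Rightarrow> 'r) conv_space)"
proof -
  interpret C: convergence_space "cfun (cfun X) :: (('a \<Rightarrow> 'r) \<Rightarrow> 'r) conv_space"
    by (intro convergence_space_cfun assms)
  have D: "D X = sub_conv (cfun (cfun X) :: (('a \<Rightarrow> 'r) \<Rightarrow> 'r) conv_space) {\<mu>. linear_functional X \<mu>}"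
    by (simp add: D_def cfun_def)
  show ?thesis
    unfolding D sub_conv_def
    by unfold_locales
      (auto dest: C.converges_point C.converges_on C.converges_proper C.converges_principal
        C.converges_finer C.converges_sup intro: order_trans simp flip: inf_principal)
qed

lemma points_D_continuous: "\<mu> \<in> points (D X) \<Longrightarrow> conv_continuous (cfun X) top_conv \<mu>"
  by (simp add: points_D_iff points_cfun_iff)

lemma conv_continuous_functional:
  assumes "convergence_space X" "convergence_space Y"
    and "conv_continuous (prod_conv X Y) top_conv h" and "\<nu> \<in> points (D Y)"
  shows "conv_continuous X top_conv (\<lambda>x. \<nu> (\<lambda>y\<in>points Y. h (x, y)))"
  using conv_continuous_compose[OF conv_continuous_curry[OF assms(1-3)] points_D_continuous[OF assms(4)]] .

lemma conv_continuous_cfun_apply: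
  assumes W: "convergence_space W" and X: "convergence_space X" and Y: "convergence_space Y"
    and f: "conv_continuous (prod_conv X Y) W f"
  shows "conv_continuous (prod_conv (prod_conv Y (cfun W)) X) top_conv (\<lambda>((y, h), x). h (f (x, y)))"
proof -
  have "((\<lambda>((y, h), x). h (f (x, y))) \<longlongrightarrow> h (f (x, y))) F"
    if "converges (prod_conv (prod_conv Y (cfun W)) X) F ((y, h), x)" for F y h x
  proof -
    have F: "converges Y (filtermap (\<lambda>z. fst (fst z)) F) y" "converges X (filtermap snd F) x"
      "converges (cfun W) (filtermap (\<lambda>z. snd (fst z)) F) h"
      using that by (auto simp: prod_conv_def filtermap_filtermap)
    then have "converges (prod_conv X Y) (filtermap (\<lambda>z. (snd z, fst (fst z))) F) (x, y)"
      by (simp add: prod_conv_def filtermap_filtermap)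
    then have "converges W (filtermap (\<lambda>z. f (snd z, fst (fst z))) F) (f (x, y))"
      using conv_continuous_converges[OF f] by (fastforce simp: filtermap_filtermap)
    from tendsto_cfun_apply[OF W F(3) this] show ?thesis
      by (simp add: case_prod_unfold)
  qed
  then show ?thesis
    by (subst conv_continuous_top_iff)
       (auto intro!: convergence_space_prod_conv convergence_space_cfun W X Y)
qed

lemma linear_functional_add:
  assumes "convergence_space X" "\<mu> \<in> points (D X)" "conv_continuous X top_conv f" "conv_continuous X top_conv g"
  shows "\<mu> (\<lambda>x\<in>points X. f x + g x) = \<mu> (restrict f (points X)) + \<mu> (restrict g (points X))"
proof -
  have "\<mu> (\<lambda>x\<in>points X. restrict f (points X) x + restrict g (points X) x)
      = \<mu> (restrict f (points X)) + \<mu> (restrict g (points X))"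
    using assms unfolding points_D_iff linear_functional_def by (blast intro: restrict_in_cfun)
  then show ?thesis by (simp cong: restrict_cong)
qed

lemma linear_functional_scale:
  assumes "convergence_space X" "\<mu> \<in> points (D X)" "conv_continuous X top_conv f"
  shows "\<mu> (\<lambda>x\<in>points X. c * f x) = c * \<mu> (restrict f (points X))"
proof -
  have "\<mu> (\<lambda>x\<in>points X. c * restrict f (points X) x) = c * \<mu> (restrict f (points X))"
    using assms unfolding points_D_iff linear_functional_def by (blast intro: restrict_in_cfun)
  then show ?thesis by (simp cong: restrict_cong)
qed

lemma D_map_eq:
  "D_map X Z g \<mu> = (\<lambda>h\<in>points (cfun Z). \<mu> (\<lambda>x\<in>points X. h (g x)))"
  by (simp add: D_map_def compose_def)

lemma conv_continuous_D_map:
  fixes \<mu> :: "('x \<Rightarrow> 'r::real_normed_field) \<Rightarrow> 'r"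
  assumes Z: "convergence_space Z" and X: "convergence_space X" and Y: "convergence_space Y"
    and f: "conv_continuous (prod_conv X Y) Z f" and \<mu>: "\<mu> \<in> points (D X)"
  shows "conv_continuous Y (D Z) (\<lambda>y. D_map X Z (\<lambda>x. f (x, y)) \<mu>)"
proof -
  let ?t = "\<lambda>y. D_map X Z (\<lambda>x. f (x, y)) \<mu>"
  have "conv_continuous (prod_conv Y (cfun Z)) top_conv (\<lambda>p. \<mu> (\<lambda>x\<in>points X. (\<lambda>((y, h), x). h (f (x, y))) (p, x)))"
    by (intro conv_continuous_functional conv_continuous_cfun_apply convergence_space_prod_conv
        convergence_space_cfun X Y Z f \<mu>)
  from conv_continuous_curry[OF Y convergence_space_cfun[OF Z] this]
  have t: "conv_continuous Y (cfun (cfun Z)) ?t"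
    by (simp add: D_map_eq)
  have lin: "linear_functional Z (?t y)" if y: "y \<in> points Y" for y
    unfolding linear_functional_def
  proof (intro conjI ballI allI)
    have fy: "conv_continuous X Z (\<lambda>x. f (x, y))"
      using conv_continuous_Pair[OF conv_continuous_prod_swap[OF f] Y X y] by simp
    then have fZ: "f (x, y) \<in> points Z" if "x \<in> points X" for x
      using that by (auto simp: conv_continuous_def)
    have c: "conv_continuous X top_conv (\<lambda>x. h (f (x, y)))" if "h \<in> points (cfun Z)" for h :: "_ \<Rightarrow> 'r"
      using conv_continuous_compose[OF fy, of top_conv h] that by (simp add: points_cfun_iff)
    show "?t y (\<lambda>z\<in>points Z. g z + h z) = ?t y g + ?t y h"
      if g: "g \<in> points (cfun Z)" and h: "h \<in> points (cfun Z)" for g h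
    proof -
      have "(\<lambda>z\<in>points Z. g z + h z) \<in> points (cfun Z)"
        using g h by (intro restrict_in_cfun Z)
          (auto simp: points_cfun_iff conv_continuous_top_iff[OF Z] intro!: tendsto_intros)
      then show ?thesis
        using g h linear_functional_add[OF X \<mu> c[OF g] c[OF h]] fZ
        by (simp add: D_map_eq cong: restrict_cong)
    qed
    show "?t y (\<lambda>z\<in>points Z. k * h z) = k * ?t y h" if h: "h \<in> points (cfun Z)" for k h
    proof -
      have "(\<lambda>z\<in>points Z. k * h z) \<in> points (cfun Z)"
        using h by (intro restrict_in_cfun Z)
          (auto simp: points_cfun_iff conv_continuous_top_iff[OF Z] intro!: tendsto_intros)
      then show ?thesis
        using h linear_functional_scale[OF X \<mu> c[OF h]] fZ
        by (simp add: D_map_eq cong: restrict_cong)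
    qed
  qed
  show ?thesis
    unfolding conv_continuous_def
  proof (intro conjI allI impI)
    show "?t \<in> points Y \<rightarrow> points (D Z)"
      using t lin by (auto simp: points_D_iff conv_continuous_def)
    fix F y assume F: "converges Y F y"
    have "filtermap ?t F \<le> principal {\<mu>. linear_functional Z \<mu>}"
      unfolding le_principal eventually_filtermap
      using eventually_in_points[OF Y F] by (rule eventually_mono) (simp add: lin)
    then show "converges (D Z) (filtermap ?t F) (?t y)"
      using t F lin convergence_space.converges_point[OF Y F]
      by (auto simp: D_def sub_conv_def cfun_def conv_continuous_def)
  qed
qed

lemma convergence_space_top_conv: "convergence_space (top_conv :: 'a::topological_space conv_space)"
proof
  show "converges top_conv (principal {x}) x" if "x \<in> points top_conv" for x :: 'a
    by (auto simp: top_conv_def principal_eq_bot_iff le_filter_def eventually_principal eventually_nhds_x_imp_x)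
qed (auto simp: top_conv_def sup_eq_bot_iff intro: order_trans)

lemma conv_continuous_eval:
  fixes h :: "'a \<Rightarrow> 'r::real_normed_field"
  assumes X: "convergence_space X" and h: "h \<in> points (cfun X)"
  shows "conv_continuous (D X) top_conv (\<lambda>\<mu>. \<mu> h)"
proof -
  interpret C: convergence_space "cfun X :: ('a \<Rightarrow> 'r) conv_space"
    by (rule convergence_space_cfun[OF X])
  have "((\<lambda>\<mu>. \<mu> h) \<longlongrightarrow> \<mu> h) F" if F: "converges (D X) F \<mu>" for F and \<mu> :: "('a \<Rightarrow> 'r) \<Rightarrow> 'r"
  proof -
    have "F \<noteq> bot"
      by (rule convergence_space.converges_proper[OF convergence_space_D[OF X] F])
    then have "converges (cfun X) (filtermap (\<lambda>_. h) F) h"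
      by (intro C.converges_finer[OF C.converges_principal[OF h]])
         (auto simp: le_principal eventually_filtermap filtermap_bot_iff)
    then show ?thesis
      using F tendsto_cfun_apply[OF C.convergence_space_axioms, of "\<lambda>\<mu>. \<mu>" F \<mu> "\<lambda>_. h"]
      by (simp add: D_def sub_conv_def cfun_def)
  qed
  then show ?thesis
    by (simp add: conv_continuous_top_iff[OF convergence_space_D[OF X]])
qed

lemma D_map_in_D:
  assumes X: "convergence_space X" and Z: "convergence_space Z"
    and g: "conv_continuous X Z g" and \<mu>: "\<mu> \<in> points (D X)"
  shows "D_map X Z g \<mu> \<in> points (D Z)"
proof -
  \<comment> \<open>a constant family; of the parameter space only nonemptiness matters\<close>
  have "conv_continuous (prod_conv X (top_conv :: real conv_space)) Z (\<lambda>p. g (fst p))"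
    using g by (auto simp: conv_continuous_def prod_conv_def simp flip: filtermap_filtermap)
  from conv_continuous_D_map[OF Z X convergence_space_top_conv this \<mu>] show ?thesis
    by (auto simp: conv_continuous_def top_conv_def)
qed

lemma iterated_integral:
  fixes a :: "(('z \<Rightarrow> 'r::real_normed_field) \<Rightarrow> 'r) \<Rightarrow> 'z"
  assumes a: "D_algebra Z a" and X: "convergence_space X" and Y: "convergence_space Y"
    and f: "conv_continuous (prod_conv X Y) Z f" and \<mu>: "\<mu> \<in> points (D X)" and \<nu>: "\<nu> \<in> points (D Y)"
  shows "D_integral Z a Y (\<lambda>y. D_integral Z a X (\<lambda>x. f (x, y)) \<mu>) \<nu> =
    a (\<lambda>h\<in>points (cfun Z). \<nu> (\<lambda>y\<in>points Y. \<mu> (\<lambda>x\<in>points X. h (f (x, y)))))"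
proof -
  have Z: "convergence_space Z" using a by (simp add: D_algebra_def)
  let ?t = "\<lambda>y. D_map X Z (\<lambda>x. f (x, y)) \<mu>"
  have t: "conv_continuous Y (D Z) ?t"
    by (rule conv_continuous_D_map[OF Z X Y f \<mu>])
  then have tD: "?t y \<in> points (D Z)" if "y \<in> points Y" for y
    using that by (auto simp: conv_continuous_def)
  have DZ: "convergence_space (D Z :: (('z \<Rightarrow> 'r) \<Rightarrow> 'r) conv_space)"
    by (rule convergence_space_D[OF Z])
  let ?\<Phi> = "D_map Y (D Z) ?t \<nu>"
  have \<Phi>: "?\<Phi> \<in> points (D (D Z))"
    by (rule D_map_in_D[OF Y DZ t \<nu>])
  have "D_map Y Z (\<lambda>y. a (?t y)) \<nu> = D_map (D Z) Z a ?\<Phi>"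
  proof -
    have "(\<lambda>\<mu>\<in>points (D Z). h (a \<mu>)) \<in> points (cfun (D Z))" if "h \<in> points (cfun Z)" for h :: "'z \<Rightarrow> 'r"
      using that conv_continuous_compose[OF D_algebra.continuous_structure[OF a], of top_conv h]
      by (intro restrict_in_cfun DZ) (simp add: points_cfun_iff)
    then show ?thesis
      using tD by (auto simp: D_map_eq fun_eq_iff restrict_def intro!: arg_cong[of _ _ \<nu>])
  qed
  moreover have "D_mult Z ?\<Phi> =
      (\<lambda>h\<in>points (cfun Z). \<nu> (\<lambda>y\<in>points Y. \<mu> (\<lambda>x\<in>points X. h (f (x, y)))))"
  proof -
    have "(\<lambda>\<mu>\<in>points (D Z). \<mu> h) \<in> points (cfun (D Z))" if h: "h \<in> points (cfun Z)" for h :: "'z \<Rightarrow> 'r"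
      by (intro restrict_in_cfun DZ conv_continuous_eval Z h)
    then show ?thesis
      using tD by (auto simp: D_mult_def D_map_eq fun_eq_iff restrict_def intro!: arg_cong[of _ _ \<nu>])
  qed
  ultimately show ?thesis
    using D_algebra.structure_mult[OF a \<Phi>] by (simp add: D_integral_def)
qed

section \<open>Supports of functionals\<close>

definition supported_on :: "'a conv_space \<Rightarrow> (('a \<Rightarrow> 'r::real_normed_field) \<Rightarrow> 'r) \<Rightarrow> 'a set \<Rightarrow> bool" where
  "supported_on X \<mu> S \<longleftrightarrow>
     (\<forall>f. conv_continuous X top_conv f \<longrightarrow> (\<forall>x\<in>S. f x = 0) \<longrightarrow> \<mu> (restrict f (points X)) = 0)"

definition covering :: "'a conv_space \<Rightarrow> 'a set set \<Rightarrow> bool" where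
  "covering X \<C> \<longleftrightarrow> (\<forall>F x. converges X F x \<longrightarrow> (\<exists>B\<in>\<C>. eventually (\<lambda>u. u \<in> B) F))"

definition ess_norm :: "'a conv_space \<Rightarrow> (('a \<Rightarrow> 'r::real_normed_field) \<Rightarrow> 'r) \<Rightarrow> ('a \<Rightarrow> 'r) \<Rightarrow> real" where
  "ess_norm X \<mu> g = Inf {c. 0 \<le> c \<and> supported_on X \<mu> {x \<in> points X. norm (g x) \<le> c}}"

locale functional = convergence_space X
  for X :: "'a conv_space" +
  fixes \<mu> :: "('a \<Rightarrow> 'r::real_normed_field) \<Rightarrow> 'r"
  assumes in_D: "\<mu> \<in> points (D X)"
begin

abbreviation cont :: "('a \<Rightarrow> 'r) \<Rightarrow> bool" where
  "cont f \<equiv> conv_continuous X top_conv f"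

abbreviation I :: "('a \<Rightarrow> 'r) \<Rightarrow> 'r" where
  "I f \<equiv> \<mu> (restrict f (points X))"

abbreviation supp :: "'a set \<Rightarrow> bool" where
  "supp \<equiv> supported_on X \<mu>"

abbreviation ess :: "('a \<Rightarrow> 'r) \<Rightarrow> real" where
  "ess \<equiv> ess_norm X \<mu>"

lemmas cont_iff = conv_continuous_top_iff[OF convergence_space_axioms]
lemmas eventually_points = eventually_in_points[OF convergence_space_axioms]

lemma I_cong: "(\<And>x. x \<in> points X \<Longrightarrow> f x = g x) \<Longrightarrow> I f = I g"
  by (simp cong: restrict_cong)

lemma I_add: "cont f \<Longrightarrow> cont g \<Longrightarrow> I (\<lambda>x. f x + g x) = I f + I g"
  by (rule linear_functional_add[OF convergence_space_axioms in_D])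

lemma I_scale: "cont f \<Longrightarrow> I (\<lambda>x. c * f x) = c * I f"
  by (rule linear_functional_scale[OF convergence_space_axioms in_D])

lemma cont_const: "cont (\<lambda>_. c)"
  by (simp add: cont_iff)

lemma I_zero: "I (\<lambda>_. 0) = 0"
  using I_scale[OF cont_const, of 0 0] by simp

lemma cont_sum: "(\<And>j. j \<in> J \<Longrightarrow> cont (f j)) \<Longrightarrow> cont (\<lambda>x. \<Sum>j\<in>J. f j x)"
  by (auto simp: cont_iff intro!: tendsto_sum)

lemma I_sum: "finite J \<Longrightarrow> (\<And>j. j \<in> J \<Longrightarrow> cont (f j)) \<Longrightarrow> I (\<lambda>x. \<Sum>j\<in>J. f j x) = (\<Sum>j\<in>J. I (f j))"
  by (induction J rule: finite_induct) (simp_all add: I_zero I_add cont_sum)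

lemma I_diff:
  assumes "cont f" "cont g"
  shows "I (\<lambda>x. f x - g x) = I f - I g"
proof -
  have "cont (\<lambda>x. - 1 * g x)"
    using assms by (auto simp: cont_iff intro!: tendsto_intros)
  from I_add[OF assms(1) this] I_scale[OF assms(2), of "- 1"] show ?thesis by simp
qed

lemma tendsto_zero_filter:
  assumes le: "\<FF> \<le> principal (points (cfun X))" and bot: "\<FF> \<noteq> bot"
    and small: "\<And>F x e. converges X F x \<Longrightarrow> 0 < e \<Longrightarrow>
      \<exists>B. eventually (\<lambda>u. u \<in> B) F \<and> eventually (\<lambda>g. \<forall>u\<in>B. norm (g u :: 'r) < e) \<FF>"
  shows "(\<mu> \<longlongrightarrow> 0) \<FF>"
proof -
  have "converges (cfun X) \<FF> (\<lambda>x\<in>points X. 0)"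
    unfolding converges_cfun_iff[OF convergence_space_axioms]
  proof (intro conjI allI impI le bot)
    show "(\<lambda>x\<in>points X. 0 :: 'r) \<in> points (cfun X)"
      by (intro restrict_in_cfun convergence_space_axioms cont_const)
    fix F x assume F: "converges X F x"
    have "((\<lambda>(g, u). g u) \<longlongrightarrow> (0 :: 'r)) (\<FF> \<times>\<^sub>F F)"
    proof (rule tendstoI)
      fix e :: real assume "0 < e"
      from small[OF F this] obtain B
        where "eventually (\<lambda>u. u \<in> B) F" "eventually (\<lambda>g. \<forall>u\<in>B. norm (g u) < e) \<FF>"
        by blast
      from eventually_prodI[OF this(2,1)]
      show "eventually (\<lambda>p. dist (case p of (g, u) \<Rightarrow> g u) 0 < e) (\<FF> \<times>\<^sub>F F)"
        by eventually_elim auto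
    qed
    then show "((\<lambda>(g, u). g u) \<longlongrightarrow> (\<lambda>x\<in>points X. 0) x) (\<FF> \<times>\<^sub>F F)"
      using converges_point[OF F] by simp
  qed
  from conv_continuous_tendsto[OF points_D_continuous[OF in_D] this] show ?thesis
    by (simp add: I_zero)
qed

lemma supp_finite_subcover:
  assumes "covering X \<C>" and sub: "\<And>B. B \<in> \<C> \<Longrightarrow> B \<subseteq> points X"
  obtains \<B> where "finite \<B>" "\<B> \<subseteq> \<C>" "supp (\<Union>\<B>)"
proof -
  define Z where "Z B = {f \<in> points (cfun X). \<forall>x\<in>B. f x = (0::'r)}" for B
  define \<FF> where "\<FF> = (INF B\<in>insert {} \<C>. principal (Z B))"
  have fin: "eventually P (INF B\<in>\<B>. principal (Z B)) \<longleftrightarrow> (\<forall>f. (\<forall>B\<in>\<B>. f \<in> Z B) \<longrightarrow> P f)"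
    if "finite \<B>" for P \<B>
    by (auto simp: INF_principal_finite[OF that] eventually_principal)
  have ev: "eventually P \<FF> \<longleftrightarrow> (\<exists>\<B>\<subseteq>insert {} \<C>. finite \<B> \<and> (\<forall>f. (\<forall>B\<in>\<B>. f \<in> Z B) \<longrightarrow> P f))" for P
    unfolding \<FF>_def
    by (subst eventually_INF, rule ex_cong1, rule conj_cong[OF refl], rule conj_cong[OF refl], rule fin)
  have "(\<mu> \<longlongrightarrow> 0) \<FF>"
  proof (rule tendsto_zero_filter)
    show "\<FF> \<le> principal (points (cfun X))"
      unfolding \<FF>_def by (rule INF_lower2[of "{}"]) (auto simp: Z_def)
    have "(\<lambda>x\<in>points X. 0) \<in> Z B" if "B \<in> insert {} \<C>" for B
      using that sub[of B] restrict_in_cfun[OF convergence_space_axioms cont_const[of 0]]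
      by (auto simp: Z_def)
    then show "\<FF> \<noteq> bot"
      unfolding trivial_limit_def ev by blast
    show "\<exists>B. eventually (\<lambda>u. u \<in> B) F \<and> eventually (\<lambda>g. \<forall>u\<in>B. norm (g u :: 'r) < e) \<FF>"
      if F: "converges X F x" and e: "0 < e" for F x e
    proof -
      obtain B where B: "B \<in> \<C>" "eventually (\<lambda>u. u \<in> B) F"
        using assms F by (auto simp: covering_def)
      have "eventually (\<lambda>g. \<forall>u\<in>B. norm (g u) < e) \<FF>"
        unfolding ev using B e by (intro exI[of _ "{B}"]) (auto simp: Z_def)
      with B show ?thesis by blast
    qed
  qed
  then have "eventually (\<lambda>f. norm (\<mu> f) < 1) \<FF>"
    by (drule_tac tendstoD[of _ _ _ 1]) auto
  then obtain \<B> where \<B>: "\<B> \<subseteq> insert {} \<C>" "finite \<B>"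
    and small: "\<And>f. (\<forall>B\<in>\<B>. f \<in> Z B) \<Longrightarrow> norm (\<mu> f) < 1"
    unfolding ev by blast
  have "I f = 0" if f: "cont f" and 0: "\<forall>x\<in>\<Union>\<B>. f x = 0" for f
  proof (rule ccontr)
    assume n: "I f \<noteq> 0"
    have "cont (\<lambda>x. inverse (I f) * f x)"
      using f by (auto simp: cont_iff intro!: tendsto_intros)
    then have "(\<lambda>x\<in>points X. inverse (I f) * f x) \<in> Z B" if "B \<in> \<B>" for B
      using that 0 sub[of B] \<B>(1) by (auto simp: Z_def intro!: restrict_in_cfun[OF convergence_space_axioms])
    moreover have "I (\<lambda>x. inverse (I f) * f x) = 1"
      using n I_scale[OF f] by simp
    ultimately show False
      using small[of "\<lambda>x\<in>points X. inverse (I f) * f x"] by auto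
  qed
  moreover have "\<Union>(\<B> - {{}}) = \<Union>\<B>" by auto
  ultimately show thesis
    using \<B> by (intro that[of "\<B> - {{}}"]) (auto simp: supported_on_def)
qed

lemma I_bounded:
  obtains C where "0 \<le> C"
    "\<And>f M. cont f \<Longrightarrow> 0 \<le> M \<Longrightarrow> (\<And>x. x \<in> points X \<Longrightarrow> norm (f x) \<le> M) \<Longrightarrow> norm (I f) \<le> C * M"
proof -
  let ?Z = "\<lambda>e. {f \<in> points (cfun X). \<forall>x\<in>points X. norm (f x :: 'r) \<le> e}"
  define \<FF> where "\<FF> = (INF e\<in>{0<..}. principal (?Z e))"
  have ev: "eventually P \<FF> \<longleftrightarrow> (\<exists>e>0. \<forall>f\<in>?Z e. P f)" for P
  proof -
    have "eventually P \<FF> \<longleftrightarrow> (\<exists>e\<in>{0<..}. eventually P (principal (?Z e)))"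
      unfolding \<FF>_def
    proof (rule eventually_INF_base)
      fix a b :: real assume "a \<in> {0<..}" "b \<in> {0<..}"
      then show "\<exists>e\<in>{0<..}. principal (?Z e) \<le> inf (principal (?Z a)) (principal (?Z b))"
        by (intro bexI[of _ "min a b"]) auto
    qed auto
    then show ?thesis by (auto simp: eventually_principal)
  qed
  have "(\<mu> \<longlongrightarrow> 0) \<FF>"
  proof (rule tendsto_zero_filter)
    show "\<FF> \<le> principal (points (cfun X))"
      unfolding \<FF>_def by (rule INF_lower2[of 1]) auto
    have "(\<lambda>x\<in>points X. 0) \<in> ?Z e" if "0 < e" for e
      using that restrict_in_cfun[OF convergence_space_axioms cont_const[of 0]] by auto
    then show "\<FF> \<noteq> bot"
      unfolding trivial_limit_def ev by blast
    show "\<exists>B. eventually (\<lambda>u. u \<in> B) F \<and> eventually (\<lambda>g. \<forall>u\<in>B. norm (g u :: 'r) < e) \<FF>"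
      if F: "converges X F x" and e: "0 < e" for F x e
    proof (intro exI conjI)
      show "eventually (\<lambda>g. \<forall>u\<in>points X. norm (g u) < e) \<FF>"
        unfolding ev using e by (intro exI[of _ "e / 2"]) (auto intro: le_less_trans)
    qed (rule eventually_points[OF F])
  qed
  then have "eventually (\<lambda>f. norm (\<mu> f) < 1) \<FF>"
    by (drule_tac tendstoD[of _ _ _ 1]) auto
  then obtain e where e: "0 < e" and small: "\<And>f. f \<in> ?Z e \<Longrightarrow> norm (\<mu> f) < 1"
    unfolding ev by blast
  show thesis
  proof (rule that[of "1 / e"])
    show "0 \<le> 1 / e" using e by simp
    fix f M assume f: "cont f" and M: "0 \<le> M" and b: "\<And>x. x \<in> points X \<Longrightarrow> norm (f x) \<le> M"
    show "norm (I f) \<le> 1 / e * M"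
    proof (cases "M = 0")
      case True
      then have "I f = I (\<lambda>_. 0)" using b by (intro I_cong) auto
      then show ?thesis by (simp add: True I_zero)
    next
      case False
      with M have M: "0 < M" by simp
      let ?g = "\<lambda>x. of_real (e / M) * f x"
      have "cont ?g"
        using f M by (auto simp: cont_iff intro!: tendsto_intros)
      moreover have "norm (?g x) \<le> e" if "x \<in> points X" for x
        using b[OF that] M e by (simp add: norm_mult norm_divide field_simps)
      ultimately have "restrict ?g (points X) \<in> ?Z e"
        by (auto intro: restrict_in_cfun[OF convergence_space_axioms])
      from small[OF this] have "norm (of_real (e / M) * I f) < 1"
        by (simp only: I_scale[OF f])
      then show ?thesis
        using M e by (simp add: norm_mult norm_divide field_simps)
    qed
  qed
qed

lemma I_bounded_supp:
  obtains C where "0 \<le> C"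
    "\<And>f S M. cont f \<Longrightarrow> supp S \<Longrightarrow> 0 \<le> M \<Longrightarrow> (\<And>x. x \<in> S \<Longrightarrow> norm (f x) \<le> M) \<Longrightarrow> norm (I f) \<le> C * M"
proof -
  obtain C where C: "0 \<le> C"
    and bd: "\<And>f M. cont f \<Longrightarrow> 0 \<le> M \<Longrightarrow> (\<And>x. x \<in> points X \<Longrightarrow> norm (f x) \<le> M) \<Longrightarrow> norm (I f) \<le> C * M"
    using I_bounded by blast
  have "norm (I f) \<le> C * M"
    if f: "cont f" and S: "supp S" and M: "0 \<le> M" and b: "\<And>x. x \<in> S \<Longrightarrow> norm (f x) \<le> M" for f S M
  proof (cases "M = 0")
    case True
    then have "I f = 0" using b S f by (auto simp: supported_on_def)
    then show ?thesis by (simp add: True)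
  next
    case False
    with M have M: "0 < M" by simp
    let ?g = "\<lambda>x. of_real (M / max M (norm (f x))) * f x"
    have g: "cont ?g"
      using f M by (auto simp: cont_iff intro!: tendsto_intros)
    have "cont (\<lambda>x. f x - ?g x)"
      using f g by (auto simp: cont_iff intro!: tendsto_diff)
    moreover have "f x - ?g x = 0" if "x \<in> S" for x
      using b[OF that] M by (simp add: max_def)
    ultimately have "I f = I ?g"
      using S I_diff[OF f g] by (auto simp: supported_on_def)
    moreover have "norm (?g x) \<le> M" for x
      using M by (auto simp: norm_mult norm_divide max_def field_simps)
    then have "norm (I ?g) \<le> C * M"
      using g M by (intro bd) auto
    ultimately show ?thesis by simp
  qed
  with C that show thesis by blast
qed

lemma supp_mono: "supp S \<Longrightarrow> S \<subseteq> T \<Longrightarrow> supp T"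
  by (auto simp: supported_on_def)

lemma supp_points: "supp (points X)"
  using I_cong[of _ "\<lambda>_. 0"] I_zero by (auto simp: supported_on_def)

text \<open>Sets carrying \<open>\<mu>\<close> are not closed under intersection in general; the slack \<open>e\<close> leaves room for a
  continuous cutoff \<open>\<theta>\<close>.\<close>

lemma supp_Int_level:
  assumes S: "supp S" and g: "cont g" and T: "supp {x \<in> points X. norm (g x) \<le> c}" and e: "0 < e"
  shows "supp (S \<inter> {x \<in> points X. norm (g x) \<le> c + e})"
  unfolding supported_on_def
proof (intro allI impI)
  fix f assume f: "cont f" and 0: "\<forall>x\<in>S \<inter> {x \<in> points X. norm (g x) \<le> c + e}. f x = 0"
  let ?\<theta> = "\<lambda>x. of_real (max 0 (min 1 ((norm (g x) - c) / e))) :: 'r"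
  have c1: "cont (\<lambda>x. ?\<theta> x * f x)" and c2: "cont (\<lambda>x. (1 - ?\<theta> x) * f x)"
    using f g e by (auto simp: cont_iff intro!: tendsto_intros)
  have "I (\<lambda>x. ?\<theta> x * f x) = 0"
    using T c1 e by (auto simp: supported_on_def field_simps)
  moreover have "I (\<lambda>x. if x \<in> points X then (1 - ?\<theta> x) * f x else 0) = 0"
  proof -
    have "cont (\<lambda>x. if x \<in> points X then (1 - ?\<theta> x) * f x else 0)"
      using c2 conv_continuous_cong[OF convergence_space_axioms, of "\<lambda>x. if x \<in> points X then (1 - ?\<theta> x) * f x else 0"]
      by simp
    moreover have "(1 - ?\<theta> x) * f x = 0" if "x \<in> S" "x \<in> points X" for x
      using that 0 e by (cases "norm (g x) \<le> c + e") (auto simp: field_simps min_def)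
    ultimately show ?thesis
      using S by (auto simp: supported_on_def)
  qed
  then have "I (\<lambda>x. (1 - ?\<theta> x) * f x) = 0"
    by (subst I_cong[of _ "\<lambda>x. if x \<in> points X then (1 - ?\<theta> x) * f x else 0"]) auto
  moreover have "I f = I (\<lambda>x. ?\<theta> x * f x + (1 - ?\<theta> x) * f x)"
    by (intro I_cong) (simp add: algebra_simps)
  ultimately show "I f = 0"
    using I_add[OF c1 c2] by simp
qed

lemma supp_Int_levels:
  assumes "finite J" and S: "supp S" and "\<And>j. j \<in> J \<Longrightarrow> cont (g j)"
    and "\<And>j. j \<in> J \<Longrightarrow> supp {x \<in> points X. norm (g j x) \<le> c}" and "0 < e"
  shows "supp (S \<inter> {x. \<forall>j\<in>J. norm (g j x) \<le> c + e})"
  using assms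
proof (induction J rule: finite_induct)
  case empty
  then show ?case by simp
next
  case (insert j J)
  have "supp ((S \<inter> {x. \<forall>j\<in>J. norm (g j x) \<le> c + e}) \<inter> {x \<in> points X. norm (g j x) \<le> c + e})"
    using insert by (intro supp_Int_level) auto
  then show ?case
    by (rule supp_mono) auto
qed

lemma ess_le:
  assumes "supp S" "S \<subseteq> points X" "0 \<le> c" "\<And>x. x \<in> S \<Longrightarrow> norm (g x) \<le> c"
  shows "ess g \<le> c"
  unfolding ess_norm_def using assms
  by (intro cInf_lower) (auto intro: supp_mono bdd_belowI[of _ 0])

lemma supp_level_ex:
  assumes g: "cont g"
  shows "\<exists>c\<ge>0. supp {x \<in> points X. norm (g x) \<le> c}"
proof -
  have "covering X (range (\<lambda>n::nat. {x \<in> points X. norm (g x) \<le> n}))"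
    unfolding covering_def
  proof (intro allI impI)
    fix F x assume F: "converges X F x"
    obtain n :: nat where n: "norm (g x) < n"
      using reals_Archimedean2 by blast
    have "((\<lambda>u. norm (g u)) \<longlongrightarrow> norm (g x)) F"
      using g F by (auto simp: cont_iff intro!: tendsto_intros)
    then have "eventually (\<lambda>u. norm (g u) < n) F"
      using n by (rule order_tendstoD)
    with eventually_points[OF F] have "eventually (\<lambda>u. u \<in> {x \<in> points X. norm (g x) \<le> n}) F"
      by eventually_elim auto
    then show "\<exists>B\<in>range (\<lambda>n::nat. {x \<in> points X. norm (g x) \<le> n}). eventually (\<lambda>u. u \<in> B) F"
      by blast
  qed
  then obtain \<B> where \<B>: "finite \<B>" "\<B> \<subseteq> range (\<lambda>n::nat. {x \<in> points X. norm (g x) \<le> n})" "supp (\<Union>\<B>)"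
    by (rule supp_finite_subcover) auto
  then obtain K where K: "finite K" "\<B> = (\<lambda>n::nat. {x \<in> points X. norm (g x) \<le> n}) ` K"
    by (meson finite_subset_image)
  have "n \<le> Max (insert 0 K)" if "n \<in> K" for n
    using K that by simp
  then have "\<Union>\<B> \<subseteq> {x \<in> points X. norm (g x) \<le> Max (insert 0 K)}"
    unfolding K by (auto elim!: order_trans)
  then have "supp {x \<in> points X. norm (g x) \<le> Max (insert 0 K)}"
    by (rule supp_mono[OF \<B>(3)])
  then show ?thesis
    using of_nat_0_le_iff by blast
qed

lemma ess_nonneg: "cont g \<Longrightarrow> 0 \<le> ess g"
  unfolding ess_norm_def using supp_level_ex by (intro cInf_greatest) auto

lemma supp_level:
  assumes g: "cont g" and "ess g < c"
  shows "supp {x \<in> points X. norm (g x) \<le> c}"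
proof -
  let ?A = "{c. 0 \<le> c \<and> supp {x \<in> points X. norm (g x) \<le> c}}"
  have "?A \<noteq> {}"
    using supp_level_ex[OF g] by auto
  then obtain c' where "c' \<in> ?A" "c' < c"
    using assms(2) cInf_lessD[of ?A c] unfolding ess_norm_def by blast
  then show ?thesis
    by (auto elim!: supp_mono)
qed

lemma ess_le_add:
  assumes f: "cont f" and g: "cont g" and S: "supp S" "S \<subseteq> points X" and c: "0 \<le> c"
    and close: "\<And>x. x \<in> S \<Longrightarrow> norm (f x - g x) \<le> c"
  shows "ess f \<le> ess g + c"
proof (rule field_le_epsilon)
  fix e :: real assume e: "0 < e"
  have "supp {x \<in> points X. norm (g x) \<le> ess g + e / 2}"
    using e by (intro supp_level g) auto
  then have *: "supp (S \<inter> {x \<in> points X. norm (g x) \<le> (ess g + e / 2) + e / 2})"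
    using e by (intro supp_Int_level S g) auto
  show "ess f \<le> ess g + c + e"
  proof (rule ess_le[OF *])
    fix x assume x: "x \<in> S \<inter> {x \<in> points X. norm (g x) \<le> (ess g + e / 2) + e / 2}"
    have "norm (f x) \<le> norm (f x - g x) + norm (g x)"
      by (metis diff_add_cancel norm_triangle_ineq)
    then show "norm (f x) \<le> ess g + c + e"
      using x close[of x] by auto
  next
    have "0 \<le> ess g"
      by (rule ess_nonneg[OF g])
    then show "0 \<le> ess g + c + e" using c e by simp
  qed (use S in auto)
qed

lemma rectangles:
  assumes Y: "convergence_space Y" and r: "conv_continuous (prod_conv X Y) top_conv (\<lambda>(x, y). r x y :: 'r)"
    and G: "converges Y G y" and e: "0 < e"
  obtains V \<D> where "eventually (\<lambda>v. v \<in> V) G" "V \<subseteq> points Y" "finite \<D>" "\<Union>\<D> \<subseteq> points X" "supp (\<Union>\<D>)"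
    "\<And>U x x' v v'. U \<in> \<D> \<Longrightarrow> x \<in> U \<Longrightarrow> x' \<in> U \<Longrightarrow> v \<in> V \<Longrightarrow> v' \<in> V \<Longrightarrow> norm (r x v - r x' v') \<le> e"
proof -
  define ok where "ok U V \<longleftrightarrow> (\<forall>x\<in>U. \<forall>x'\<in>U. \<forall>v\<in>V. \<forall>v'\<in>V. norm (r x v - r x' v') \<le> e)" for U V
  define \<C> where "\<C> = {U. U \<subseteq> points X \<and> (\<exists>V\<subseteq>points Y. eventually (\<lambda>v. v \<in> V) G \<and> ok U V)}"
  have "covering X \<C>"
    unfolding covering_def
  proof (intro allI impI)
    fix F x assume F: "converges X F x"
    have "((\<lambda>(x, y). r x y) \<longlongrightarrow> r x y) (F \<times>\<^sub>F G)"
      using conv_continuous_tendsto[OF r converges_prod_filter[OF convergence_space_axioms Y F G]] by simp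
    then have "eventually (\<lambda>p. dist (case p of (x, y) \<Rightarrow> r x y) (r x y) < e / 2) (F \<times>\<^sub>F G)"
      using e by (intro tendstoD) auto
    then obtain P Q where P: "eventually P F" and Q: "eventually Q G"
      and PQ: "\<And>u v. P u \<Longrightarrow> Q v \<Longrightarrow> dist (r u v) (r x y) < e / 2"
      unfolding eventually_prod_filter by auto
    let ?U = "{u \<in> points X. P u}" and ?V = "{v \<in> points Y. Q v}"
    have "norm (r a b - r a' b') \<le> e" if "P a" "P a'" "Q b" "Q b'" for a a' b b'
      using dist_triangle_half_l[OF PQ PQ, of a b a' b'] that by (simp add: dist_norm)
    then have "ok ?U ?V" by (auto simp: ok_def)
    moreover have "eventually (\<lambda>v. v \<in> ?V) G"
      using Q eventually_in_points[OF Y G] by eventually_elim auto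
    ultimately have "?U \<in> \<C>"
      unfolding \<C>_def by (intro CollectI conjI exI[of _ ?V]) auto
    moreover have "eventually (\<lambda>u. u \<in> ?U) F"
      using P eventually_points[OF F] by eventually_elim auto
    ultimately show "\<exists>B\<in>\<C>. eventually (\<lambda>u. u \<in> B) F" by blast
  qed
  then obtain \<D> where \<D>: "finite \<D>" "\<D> \<subseteq> \<C>" "supp (\<Union>\<D>)"
    by (rule supp_finite_subcover) (auto simp: \<C>_def)
  then have "\<forall>U\<in>\<D>. \<exists>V. V \<subseteq> points Y \<and> eventually (\<lambda>v. v \<in> V) G \<and> ok U V"
    unfolding \<C>_def by blast
  from bchoice[OF this]
  obtain V where V: "\<And>U. U \<in> \<D> \<Longrightarrow> V U \<subseteq> points Y \<and> eventually (\<lambda>v. v \<in> V U) G \<and> ok U (V U)"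
    by blast
  have "eventually (\<lambda>v. \<forall>U\<in>\<D>. v \<in> V U) G"
    using \<D>(1) V by (intro eventually_ball_finite) auto
  then have "eventually (\<lambda>v. v \<in> {v \<in> points Y. \<forall>U\<in>\<D>. v \<in> V U}) G"
    using eventually_in_points[OF Y G] by eventually_elim auto
  moreover have "\<Union>\<D> \<subseteq> points X" using \<D>(2) by (auto simp: \<C>_def)
  ultimately show thesis
    using \<D> V by (intro that[of "{v \<in> points Y. \<forall>U\<in>\<D>. v \<in> V U}" \<D>]) (auto simp: ok_def)
qed

lemma cont_section:
  assumes "convergence_space Y" "conv_continuous (prod_conv X Y) top_conv (\<lambda>(x, y). r x y :: 'r)" "y \<in> points Y"
  shows "cont (\<lambda>x. r x y)"
  using conv_continuous_Pair[OF conv_continuous_prod_swap[OF assms(2)] assms(1) convergence_space_axioms assms(3)]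
  by simp

lemma ess_continuous:
  assumes Y: "convergence_space Y" and r: "conv_continuous (prod_conv X Y) top_conv (\<lambda>(x, y). r x y :: 'r)"
  shows "conv_continuous Y top_conv (\<lambda>y. ess (\<lambda>x. r x y))"
  unfolding conv_continuous_top_iff[OF Y]
proof (intro allI impI tendstoI)
  fix G y and e :: real assume G: "converges Y G y" and e: "0 < e"
  have y: "y \<in> points Y"
    by (rule convergence_space.converges_point[OF Y G])
  have "converges Y (sup G (principal {y})) y"
    by (intro convergence_space.converges_sup[OF Y] G convergence_space.converges_principal[OF Y] y)
  from rectangles[OF Y r this half_gt_zero[OF e]]
  obtain V \<D> where V: "eventually (\<lambda>v. v \<in> V) (sup G (principal {y}))" "V \<subseteq> points Y"
    and \<D>: "\<Union>\<D> \<subseteq> points X" "supp (\<Union>\<D>)"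
    and osc: "\<And>U x x' v v'. U \<in> \<D> \<Longrightarrow> x \<in> U \<Longrightarrow> x' \<in> U \<Longrightarrow> v \<in> V \<Longrightarrow> v' \<in> V \<Longrightarrow> norm (r x v - r x' v') \<le> e / 2"
    by metis
  have yV: "y \<in> V" and evV: "eventually (\<lambda>v. v \<in> V) G"
    using V(1) by (auto simp: eventually_sup eventually_principal)
  have le: "ess (\<lambda>x. r x v) \<le> ess (\<lambda>x. r x v') + e / 2" if "v \<in> V" "v' \<in> V" for v v'
    using that V(2) e osc by (intro ess_le_add[OF _ _ \<D>(2,1)] cont_section[OF Y r]) auto
  from evV show "eventually (\<lambda>v. dist (ess (\<lambda>x. r x v)) (ess (\<lambda>x. r x y)) < e) G"
  proof eventually_elim
    case (elim v)
    then show ?case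
      using le[OF elim yV] le[OF yV elim] e by (simp add: dist_real_def abs_less_iff)
  qed
qed

end

section \<open>Fubini's theorem for scalar functions\<close>

locale functional_pair = M: functional X \<mu> + N: functional Y \<nu>
  for X :: "'a conv_space" and \<mu> :: "('a \<Rightarrow> 'r::real_normed_field) \<Rightarrow> 'r"
    and Y :: "'b conv_space" and \<nu> :: "('b \<Rightarrow> 'r) \<Rightarrow> 'r"
begin

abbreviation cont2 :: "('a \<Rightarrow> 'b \<Rightarrow> 'r) \<Rightarrow> bool" where
  "cont2 r \<equiv> conv_continuous (prod_conv X Y) top_conv (\<lambda>(x, y). r x y)"

lemma cont2_swap: "cont2 r \<Longrightarrow> conv_continuous (prod_conv Y X) top_conv (\<lambda>(y, x). r x y)"
  using conv_continuous_prod_swap[of X Y top_conv "\<lambda>(x, y). r x y"] by simp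

lemma cont2_section1: "cont2 r \<Longrightarrow> y \<in> points Y \<Longrightarrow> M.cont (\<lambda>x. r x y)"
  by (rule M.cont_section[OF N.convergence_space_axioms])

lemma cont2_section2: "cont2 r \<Longrightarrow> x \<in> points X \<Longrightarrow> N.cont (\<lambda>y. r x y)"
  by (rule N.cont_section[OF M.convergence_space_axioms cont2_swap])

lemma cont2_I1: "cont2 r \<Longrightarrow> N.cont (\<lambda>y. M.I (\<lambda>x. r x y))"
  using conv_continuous_functional[OF N.convergence_space_axioms M.convergence_space_axioms cont2_swap M.in_D]
  by simp

lemma cont2_I2: "cont2 r \<Longrightarrow> M.cont (\<lambda>x. N.I (\<lambda>y. r x y))"
  using conv_continuous_functional[OF M.convergence_space_axioms N.convergence_space_axioms _ N.in_D,
      of "\<lambda>(x, y). r x y"]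
  by simp

lemma cont2_iff: "cont2 r \<longleftrightarrow>
    (\<forall>F x y. converges X (filtermap fst F) x \<and> converges Y (filtermap snd F) y \<longrightarrow>
       ((\<lambda>p. r (fst p) (snd p)) \<longlongrightarrow> r x y) F)"
  unfolding conv_continuous_top_iff[OF convergence_space_prod_conv[OF M.convergence_space_axioms
      N.convergence_space_axioms]]
  by (simp add: prod_conv_def case_prod_unfold)

lemma cont2_fst: "M.cont f \<Longrightarrow> cont2 (\<lambda>x y. f x)"
  and cont2_snd: "N.cont g \<Longrightarrow> cont2 (\<lambda>x y. g y)"
  by (auto simp: cont2_iff M.cont_iff N.cont_iff
      simp flip: filterlim_filtermap[of f _ fst] filterlim_filtermap[of g _ snd])

lemma cont2_tensor_sum:
  assumes "finite J" "\<And>j. j \<in> J \<Longrightarrow> M.cont (\<phi> j)" "\<And>j. j \<in> J \<Longrightarrow> N.cont (g j)"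
  shows "cont2 (\<lambda>x y. \<Sum>j\<in>J. \<phi> j x * g j y)"
  unfolding cont2_iff
proof (intro allI impI tendsto_sum tendsto_mult)
  fix F x y j assume "converges X (filtermap fst F) x \<and> converges Y (filtermap snd F) y" and j: "j \<in> J"
  then show "((\<lambda>p. \<phi> j (fst p)) \<longlongrightarrow> \<phi> j x) F" "((\<lambda>p. g j (snd p)) \<longlongrightarrow> g j y) F"
    using cont2_fst[OF assms(2)[OF j]] cont2_snd[OF assms(3)[OF j]] by (auto simp: cont2_iff)
qed

lemma cont2_diff: "cont2 r \<Longrightarrow> cont2 s \<Longrightarrow> cont2 (\<lambda>x y. r x y - s x y)"
  by (auto simp: cont2_iff intro!: tendsto_diff)

text \<open>The partition of unity is \<open>\<phi> j = \<psi> j / s\<close>, cut off from the functions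
  \<open>d j x = ess (h x - h j)\<close>; the indices \<open>j\<close> are points of \<open>X\<close>.\<close>

lemma tensor_approximation:
  assumes h: "cont2 h" and e: "0 < e"
  obtains J \<phi> where "finite J" "J \<subseteq> points X" "\<And>j. j \<in> J \<Longrightarrow> M.cont (\<phi> j)"
    "M.supp {x \<in> points X. N.ess (\<lambda>y. h x y - (\<Sum>j\<in>J. \<phi> j x * h j y)) \<le> 3 * e}"
proof -
  define \<C> where "\<C> = {B. B \<subseteq> points X \<and> B \<noteq> {} \<and>
    (\<forall>x\<in>B. \<forall>x'\<in>B. N.ess (\<lambda>y. h x y - h x' y) \<le> e)}"
  have "covering X \<C>"
    unfolding covering_def
  proof (intro allI impI)
    fix F x assume F: "converges X F x"
    from N.rectangles[OF M.convergence_space_axioms cont2_swap[OF h] F e]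
    obtain B \<D> where B: "eventually (\<lambda>u. u \<in> B) F" "B \<subseteq> points X"
      and \<D>: "\<Union>\<D> \<subseteq> points Y" "N.supp (\<Union>\<D>)"
      and osc: "\<And>V y y' x x'. V \<in> \<D> \<Longrightarrow> y \<in> V \<Longrightarrow> y' \<in> V \<Longrightarrow> x \<in> B \<Longrightarrow> x' \<in> B \<Longrightarrow> norm (h x y - h x' y') \<le> e"
      by metis
    have "N.ess (\<lambda>y. h x y - h x' y) \<le> e" if "x \<in> B" "x' \<in> B" for x x'
      using that e osc by (intro N.ess_le[OF \<D>(2,1)]) auto
    moreover have "B \<noteq> {}"
      using B(1) M.converges_proper[OF F] by (auto simp: trivial_limit_def)
    ultimately have "B \<in> \<C>" using B(2) by (auto simp: \<C>_def)
    with B(1) show "\<exists>B\<in>\<C>. eventually (\<lambda>u. u \<in> B) F" by blast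
  qed
  then obtain \<B> where \<B>: "finite \<B>" "\<B> \<subseteq> \<C>" "M.supp (\<Union>\<B>)"
    by (rule M.supp_finite_subcover) (auto simp: \<C>_def)
  define J where "J = (\<lambda>B. SOME x. x \<in> B) ` \<B>"
  have pick: "(SOME x. x \<in> B) \<in> B" if "B \<in> \<B>" for B
    using that \<B>(2) by (auto simp: \<C>_def some_in_eq)
  have J: "finite J" "J \<subseteq> points X"
    unfolding J_def using \<B>(1) \<B>(2)[unfolded \<C>_def] pick by blast+
  have near: "\<exists>j\<in>J. N.ess (\<lambda>y. h x y - h j y) \<le> e" if "x \<in> \<Union>\<B>" for x
    unfolding J_def using that pick \<B>(2)[unfolded \<C>_def] by blast
  define d where "d j x = N.ess (\<lambda>y. h x y - h j y)" for j x
  define \<psi> where "\<psi> j x = max 0 (2 * e - d j x)" for j x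
  define s where "s x = max e (\<Sum>j\<in>J. \<psi> j x)" for x
  define \<phi> where "\<phi> j x = (of_real (\<psi> j x / s x) :: 'r)" for j x
  have s: "0 < s x" for x using e by (simp add: s_def)
  have d: "conv_continuous X top_conv (d j)" if "j \<in> J" for j
    unfolding d_def
    using that J(2) by (intro N.ess_continuous M.convergence_space_axioms cont2_swap cont2_diff h
        cont2_snd cont2_section2) auto
  then have "((\<lambda>x. \<psi> j x) \<longlongrightarrow> \<psi> j x) F" if "converges X F x" "j \<in> J" for F x j
    unfolding \<psi>_def using that by (auto simp: conv_continuous_top_iff M.convergence_space_axioms intro!: tendsto_intros)
  then have \<phi>: "M.cont (\<phi> j)" if "j \<in> J" for j
    unfolding M.cont_iff \<phi>_def using that s[unfolded s_def]
    by (auto simp: s_def less_imp_neq[symmetric] intro!: tendsto_intros)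
  have "N.ess (\<lambda>y. h x y - (\<Sum>j\<in>J. \<phi> j x * h j y)) \<le> 3 * e" if x: "x \<in> \<Union>\<B>" for x
  proof -
    have xX: "x \<in> points X" using x \<B>(2) by (auto simp: \<C>_def)
    obtain j where j: "j \<in> J" "d j x \<le> e" using near[OF x] by (auto simp: d_def)
    have "e \<le> \<psi> j x" using j(2) by (simp add: \<psi>_def)
    also have "\<dots> \<le> (\<Sum>j\<in>J. \<psi> j x)"
      using j(1) J(1) by (intro member_le_sum) (auto simp: \<psi>_def)
    finally have s_eq: "s x = (\<Sum>j\<in>J. \<psi> j x)" by (simp add: s_def)
    have sum1: "(\<Sum>j\<in>J. \<psi> j x / s x) = 1"
      using s[of x] by (simp add: s_eq flip: sum_divide_distrib)
    then have \<phi>1: "(\<Sum>j\<in>J. \<phi> j x) = 1"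
      unfolding \<phi>_def of_real_sum[symmetric] by simp
    let ?J = "{j \<in> J. d j x < 2 * e}"
    have *: "N.supp (points Y \<inter> {y. \<forall>j\<in>?J. norm (h x y - h j y) \<le> 2 * e + e})"
    proof (rule N.supp_Int_levels)
      show "N.cont (\<lambda>y. h x y - h j y)" if "j \<in> ?J" for j
        using cont2_section2[OF h xX] cont2_section2[OF h, of j] that J(2)
        by (auto simp: N.cont_iff intro!: tendsto_diff)
      then show "N.supp {y \<in> points Y. norm (h x y - h j y) \<le> 2 * e}" if "j \<in> ?J" for j
        using that by (intro N.supp_level) (auto simp: d_def)
    qed (use J e N.supp_points in auto)
    show ?thesis
    proof (rule N.ess_le[OF *])
      fix y assume y: "y \<in> points Y \<inter> {y. \<forall>j\<in>?J. norm (h x y - h j y) \<le> 2 * e + e}"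
      have "h x y - (\<Sum>j\<in>J. \<phi> j x * h j y) = (\<Sum>j\<in>J. \<phi> j x) * h x y - (\<Sum>j\<in>J. \<phi> j x * h j y)"
        by (simp add: \<phi>1)
      also have "\<dots> = (\<Sum>j\<in>J. \<phi> j x * (h x y - h j y))"
        by (simp add: sum_distrib_right sum_subtractf right_diff_distrib)
      also have "norm \<dots> \<le> (\<Sum>j\<in>J. \<psi> j x / s x * (3 * e))"
      proof (rule sum_norm_le)
        fix j assume j: "j \<in> J"
        show "norm (\<phi> j x * (h x y - h j y)) \<le> \<psi> j x / s x * (3 * e)"
        proof (cases "d j x < 2 * e")
          case True
          then have "norm (h x y - h j y) \<le> 3 * e" using y j by auto
          moreover have "norm (\<phi> j x) = \<psi> j x / s x" "0 \<le> \<psi> j x / s x"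
            using s[of x] by (auto simp: \<phi>_def \<psi>_def norm_divide)
          ultimately show ?thesis
            by (simp add: norm_mult mult_left_mono del: times_divide_eq_left)
        next
          case False
          then show ?thesis by (simp add: \<phi>_def \<psi>_def)
        qed
      qed
      also have "\<dots> = 3 * e" unfolding sum_distrib_right[symmetric] sum1 by simp
      finally show "norm (h x y - (\<Sum>j\<in>J. \<phi> j x * h j y)) \<le> 3 * e" .
    qed (use e in auto)
  qed
  then have "M.supp {x \<in> points X. N.ess (\<lambda>y. h x y - (\<Sum>j\<in>J. \<phi> j x * h j y)) \<le> 3 * e}"
    using \<B>(2) by (intro M.supp_mono[OF \<B>(3)]) (auto simp: \<C>_def)
  with J \<phi> show thesis by (rule that)
qed

lemma swapped_integral_bound:
  assumes CM: "\<And>f S M. M.cont f \<Longrightarrow> M.supp S \<Longrightarrow> 0 \<le> M \<Longrightarrow> (\<And>x. x \<in> S \<Longrightarrow> norm (f x) \<le> M) \<Longrightarrow> norm (M.I f) \<le> CM * M"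
    and CN: "\<And>f S M. N.cont f \<Longrightarrow> N.supp S \<Longrightarrow> 0 \<le> M \<Longrightarrow> (\<And>x. x \<in> S \<Longrightarrow> norm (f x) \<le> M) \<Longrightarrow> norm (N.I f) \<le> CN * M"
    and "0 \<le> CM"
    and r: "cont2 r" and c: "0 \<le> c" and e: "0 < e"
    and small: "M.supp {x \<in> points X. N.ess (\<lambda>y. r x y) \<le> c}"
  shows "norm (N.I (\<lambda>y. M.I (\<lambda>x. r x y))) \<le> CN * (CM * (c + 4 * e))"
proof -
  define P where "P = {x \<in> points X. N.ess (\<lambda>y. r x y) \<le> c + e}"
  define good where "good V \<D> \<longleftrightarrow> finite \<D> \<and> M.supp (\<Union>\<D>) \<and>
     (\<forall>U\<in>\<D>. \<forall>x\<in>U. \<forall>x'\<in>U. \<forall>v\<in>V. norm (r x v - r x' v) \<le> e)" for V \<D>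
  define \<C> where "\<C> = {V. V \<subseteq> points Y \<and> (\<exists>\<D>. good V \<D>)}"
  have "covering Y \<C>"
    unfolding covering_def
  proof (intro allI impI)
    fix G y assume G: "converges Y G y"
    from M.rectangles[OF N.convergence_space_axioms r G e]
    obtain V \<D> where V: "eventually (\<lambda>v. v \<in> V) G" "V \<subseteq> points Y"
      and \<D>: "finite \<D>" "M.supp (\<Union>\<D>)"
      and osc: "\<And>U x x' v v'. U \<in> \<D> \<Longrightarrow> x \<in> U \<Longrightarrow> x' \<in> U \<Longrightarrow> v \<in> V \<Longrightarrow> v' \<in> V \<Longrightarrow> norm (r x v - r x' v') \<le> e"
      by metis
    have "good V \<D>" using V(2) \<D> osc by (auto simp: good_def)
    then have "V \<in> \<C>" using V(2) by (auto simp: \<C>_def)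
    with V(1) show "\<exists>B\<in>\<C>. eventually (\<lambda>u. u \<in> B) G" by blast
  qed
  then obtain \<V> where \<V>: "finite \<V>" "\<V> \<subseteq> \<C>" "N.supp (\<Union>\<V>)"
    by (rule N.supp_finite_subcover) (auto simp: \<C>_def)
  then have "\<forall>V\<in>\<V>. \<exists>\<D>. good V \<D>"
    by (auto simp: \<C>_def)
  from bchoice[OF this] obtain \<D> where good: "\<And>V. V \<in> \<V> \<Longrightarrow> good V (\<D> V)"
    by blast
  then have \<D>: "\<And>V. V \<in> \<V> \<Longrightarrow> finite (\<D> V) \<and> M.supp (\<Union>(\<D> V))"
    and osc: "\<And>V U x x' v. V \<in> \<V> \<Longrightarrow> U \<in> \<D> V \<Longrightarrow> x \<in> U \<Longrightarrow> x' \<in> U \<Longrightarrow> v \<in> V \<Longrightarrow> norm (r x v - r x' v) \<le> e"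
    by (auto simp: good_def)
  define t where "t U = (SOME x. x \<in> U \<inter> P)" for U
  define T where "T = t ` {U \<in> \<Union>(\<D> ` \<V>). U \<inter> P \<noteq> {}}"
  have t: "t U \<in> U \<inter> P" if "U \<inter> P \<noteq> {}" for U
    using that unfolding t_def by (subst some_in_eq)
  have "finite T" unfolding T_def using \<V>(1) \<D> by auto
  have TP: "T \<subseteq> P" using t unfolding T_def by blast
  have Q: "N.supp (\<Union>\<V> \<inter> {y. \<forall>x\<in>T. norm (r x y) \<le> (c + 2 * e) + e})" (is "N.supp ?Q")
  proof (rule N.supp_Int_levels[OF \<open>finite T\<close> \<V>(3)])
    fix x assume "x \<in> T"
    then have x: "x \<in> points X" "N.ess (\<lambda>y. r x y) < c + 2 * e"
      using TP e by (auto simp: P_def)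
    show "N.cont (\<lambda>y. r x y)" by (rule cont2_section2[OF r x(1)])
    then show "N.supp {y \<in> points Y. norm (r x y) \<le> c + 2 * e}"
      by (rule N.supp_level[OF _ x(2)])
  qed (rule e)
  show ?thesis
  proof (rule CN[OF cont2_I1[OF r] Q])
    show "0 \<le> CM * (c + 4 * e)" using \<open>0 \<le> CM\<close> c e by simp
    fix y assume y: "y \<in> ?Q"
    then obtain V where V: "V \<in> \<V>" "y \<in> V" by auto
    have yY: "y \<in> points Y" using V \<V>(2) by (auto simp: \<C>_def)
    have ess_cont: "conv_continuous X top_conv (\<lambda>x. N.ess (\<lambda>y. r x y))"
      by (rule N.ess_continuous[OF M.convergence_space_axioms cont2_swap[OF r]])
    have "conv_continuous X top_conv (\<lambda>x. of_real (N.ess (\<lambda>y. r x y)) :: 'r)"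
      using ess_cont by (auto simp: conv_continuous_top_iff M.convergence_space_axioms intro!: tendsto_of_real)
    moreover have ess_abs: "\<bar>N.ess (\<lambda>y. r x y)\<bar> = N.ess (\<lambda>y. r x y)" if "x \<in> points X" for x
      using N.ess_nonneg[OF cont2_section2[OF r that]] by simp
    moreover have "{x \<in> points X. norm (of_real (N.ess (\<lambda>y. r x y)) :: 'r) \<le> k} = {x \<in> points X. N.ess (\<lambda>y. r x y) \<le> k}" for k
      using ess_abs by auto
    ultimately have "M.supp (\<Union>(\<D> V) \<inter> P)"
      using M.supp_Int_level[of "\<Union>(\<D> V)" "\<lambda>x. of_real (N.ess (\<lambda>y. r x y))" c e] \<D>[OF V(1)] small e
      by (simp add: P_def)
    then show "norm (M.I (\<lambda>x. r x y)) \<le> CM * (c + 4 * e)"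
    proof (rule CM[OF cont2_section1[OF r yY]])
      fix x assume x: "x \<in> \<Union>(\<D> V) \<inter> P"
      then obtain U where U: "U \<in> \<D> V" "x \<in> U" by auto
      then have ne: "U \<inter> P \<noteq> {}" using x by auto
      have "t U \<in> T" using U(1) V(1) ne by (auto simp: T_def)
      then have "norm (r (t U) y) \<le> c + 2 * e + e" using y by auto
      moreover have "norm (r x y - r (t U) y) \<le> e"
        using osc[OF V(1) U(1,2) _ V(2)] t[OF ne] by auto
      ultimately show "norm (r x y) \<le> c + 4 * e"
        using norm_triangle_ineq[of "r x y - r (t U) y" "r (t U) y"] by simp
    qed (use c e in auto)
  qed
qed

theorem functional_Fubini:
  assumes h: "cont2 h"
  shows "N.I (\<lambda>y. M.I (\<lambda>x. h x y)) = M.I (\<lambda>x. N.I (\<lambda>y. h x y))"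
proof -
  obtain CM where CM0: "0 \<le> CM" and
    CM: "\<And>f S M. M.cont f \<Longrightarrow> M.supp S \<Longrightarrow> 0 \<le> M \<Longrightarrow> (\<And>x. x \<in> S \<Longrightarrow> norm (f x) \<le> M) \<Longrightarrow> norm (M.I f) \<le> CM * M"
    using M.I_bounded_supp by blast
  obtain CN where CN0: "0 \<le> CN" and
    CN: "\<And>f S M. N.cont f \<Longrightarrow> N.supp S \<Longrightarrow> 0 \<le> M \<Longrightarrow> (\<And>x. x \<in> S \<Longrightarrow> norm (f x) \<le> M) \<Longrightarrow> norm (N.I f) \<le> CN * M"
    using N.I_bounded_supp by blast
  have bound: "norm (N.I (\<lambda>y. M.I (\<lambda>x. h x y)) - M.I (\<lambda>x. N.I (\<lambda>y. h x y))) \<le> 11 * CM * CN * e"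
    if e: "0 < e" for e
  proof -
    obtain J \<phi> where J: "finite J" "J \<subseteq> points X" "\<And>j. j \<in> J \<Longrightarrow> M.cont (\<phi> j)"
      and small: "M.supp {x \<in> points X. N.ess (\<lambda>y. h x y - (\<Sum>j\<in>J. \<phi> j x * h j y)) \<le> 3 * e}" (is "M.supp ?S")
      using tensor_approximation[OF h e] by blast
    define w where "w x y = (\<Sum>j\<in>J. \<phi> j x * h j y)" for x y
    define r where "r x y = h x y - w x y" for x y
    have hj: "N.cont (h j)" if "j \<in> J" for j
      using cont2_section2[OF h, of j] that J(2) by auto
    have w: "cont2 w"
      unfolding w_def by (rule cont2_tensor_sum[OF J(1,3) hj])
    have r: "cont2 r"
      unfolding r_def by (rule cont2_diff[OF h w])
    have cm: "M.cont (\<lambda>x. \<phi> j x * k)" if "j \<in> J" for j k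
      using J(3)[OF that] by (auto simp: M.cont_iff intro!: tendsto_intros)
    have cn: "N.cont (\<lambda>y. k * h j y)" if "j \<in> J" for j k
      using hj[OF that] by (auto simp: N.cont_iff intro!: tendsto_intros)
    have Im: "M.I (\<lambda>x. \<phi> j x * k) = k * M.I (\<phi> j)" if "j \<in> J" for j k
      using M.I_scale[OF J(3)[OF that], of k] by (simp add: mult.commute)
    have "N.I (\<lambda>y. M.I (\<lambda>x. w x y)) = N.I (\<lambda>y. \<Sum>j\<in>J. M.I (\<phi> j) * h j y)"
      unfolding w_def by (simp add: M.I_sum J(1) cm Im mult.commute cong: sum.cong)
    also have "\<dots> = (\<Sum>j\<in>J. M.I (\<phi> j) * N.I (h j))"
      by (simp add: N.I_sum J(1) cn N.I_scale hj)
    also have "\<dots> = M.I (\<lambda>x. \<Sum>j\<in>J. \<phi> j x * N.I (h j))"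
      by (simp add: M.I_sum J(1) cm Im mult.commute)
    also have "\<dots> = M.I (\<lambda>x. N.I (\<lambda>y. w x y))"
      unfolding w_def by (simp add: N.I_sum J(1) cn N.I_scale hj)
    finally have w_eq: "N.I (\<lambda>y. M.I (\<lambda>x. w x y)) = M.I (\<lambda>x. N.I (\<lambda>y. w x y))" .
    have "N.I (\<lambda>y. M.I (\<lambda>x. r x y)) = N.I (\<lambda>y. M.I (\<lambda>x. h x y) - M.I (\<lambda>x. w x y))"
      unfolding r_def by (intro N.I_cong M.I_diff cont2_section1 h w)
    then have r1: "N.I (\<lambda>y. M.I (\<lambda>x. r x y)) = N.I (\<lambda>y. M.I (\<lambda>x. h x y)) - N.I (\<lambda>y. M.I (\<lambda>x. w x y))"
      by (simp only: N.I_diff[OF cont2_I1[OF h] cont2_I1[OF w]])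
    have "M.I (\<lambda>x. N.I (\<lambda>y. r x y)) = M.I (\<lambda>x. N.I (\<lambda>y. h x y) - N.I (\<lambda>y. w x y))"
      unfolding r_def by (intro M.I_cong N.I_diff cont2_section2 h w)
    then have r2: "M.I (\<lambda>x. N.I (\<lambda>y. r x y)) = M.I (\<lambda>x. N.I (\<lambda>y. h x y)) - M.I (\<lambda>x. N.I (\<lambda>y. w x y))"
      by (simp only: M.I_diff[OF cont2_I2[OF h] cont2_I2[OF w]])
    have small: "M.supp {x \<in> points X. N.ess (\<lambda>y. r x y) \<le> 3 * e}"
      using small unfolding r_def w_def .
    have "norm (N.I (\<lambda>y. M.I (\<lambda>x. r x y))) \<le> CN * (CM * (3 * e + 4 * e))"
      using e by (intro swapped_integral_bound[OF CM CN CM0 r _ e small]) auto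
    moreover have "norm (M.I (\<lambda>x. N.I (\<lambda>y. r x y))) \<le> CM * (CN * (4 * e))"
    proof (rule CM[OF cont2_I2[OF r] small])
      show "0 \<le> CN * (4 * e)" using CN0 e by simp
      fix x assume x: "x \<in> {x \<in> points X. N.ess (\<lambda>y. r x y) \<le> 3 * e}"
      then have c: "N.cont (\<lambda>y. r x y)" by (intro cont2_section2 r) auto
      have "N.supp {y \<in> points Y. norm (r x y) \<le> 4 * e}"
        using x e by (intro N.supp_level c) auto
      then show "norm (N.I (\<lambda>y. r x y)) \<le> CN * (4 * e)"
        using e by (intro CN[OF c]) auto
    qed
    moreover have "N.I (\<lambda>y. M.I (\<lambda>x. h x y)) - M.I (\<lambda>x. N.I (\<lambda>y. h x y))
        = N.I (\<lambda>y. M.I (\<lambda>x. r x y)) - M.I (\<lambda>x. N.I (\<lambda>y. r x y))"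
      using r1 r2 w_eq by simp
    ultimately have "norm (N.I (\<lambda>y. M.I (\<lambda>x. h x y)) - M.I (\<lambda>x. N.I (\<lambda>y. h x y)))
        \<le> CN * (CM * (3 * e + 4 * e)) + CM * (CN * (4 * e))"
      by (simp only:) (intro order_trans[OF norm_triangle_ineq4] add_mono)
    then show ?thesis by (simp add: algebra_simps)
  qed
  define K where "K = 11 * CM * CN + 1"
  have K: "0 < K" using CM0 CN0 by (simp add: K_def add_nonneg_pos)
  have "norm (N.I (\<lambda>y. M.I (\<lambda>x. h x y)) - M.I (\<lambda>x. N.I (\<lambda>y. h x y))) \<le> 0 + e" if "0 < e" for e
  proof -
    have "11 * CM * CN * (e / K) \<le> K * (e / K)"
      using that K by (intro mult_right_mono) (auto simp: K_def)
    then show ?thesis using bound[of "e / K"] that K by simp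
  qed
  then have "norm (N.I (\<lambda>y. M.I (\<lambda>x. h x y)) - M.I (\<lambda>x. N.I (\<lambda>y. h x y))) \<le> 0"
    by (rule field_le_epsilon)
  then show ?thesis by simp
qed

end

lemma D_algebra_Fubini:
  fixes a :: "(('z \<Rightarrow> 'r::real_normed_field) \<Rightarrow> 'r) \<Rightarrow> 'z"
  assumes a: "D_algebra Z a" and X: "convergence_space X" and Y: "convergence_space Y"
    and f: "conv_continuous (prod_conv X Y) Z f" and \<mu>: "\<mu> \<in> points (D X)" and \<nu>: "\<nu> \<in> points (D Y)"
  shows "D_integral Z a Y (\<lambda>y. D_integral Z a X (\<lambda>x. f (x, y)) \<mu>) \<nu>
      = D_integral Z a (prod_conv X Y) f (D_tensor X Y \<mu> \<nu>)"
    and "D_integral Z a (prod_conv X Y) f (D_tensor X Y \<mu> \<nu>)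
      = D_integral Z a X (\<lambda>x. D_integral Z a Y (\<lambda>y. f (x, y)) \<nu>) \<mu>"
proof -
  interpret functional_pair X \<mu> Y \<nu>
    using X Y \<mu> \<nu> by (simp add: functional_pair_def functional_def functional_axioms_def)
  have hf: "conv_continuous (prod_conv X Y) top_conv (\<lambda>p. h (f p))" if "h \<in> points (cfun Z)" for h :: "'z \<Rightarrow> 'r"
    using conv_continuous_compose[OF f, of top_conv h] that by (simp add: points_cfun_iff)
  have tensor: "D_map (prod_conv X Y) Z f (D_tensor X Y \<mu> \<nu>) =
      (\<lambda>h\<in>points (cfun Z). N.I (\<lambda>y. M.I (\<lambda>x. h (f (x, y)))))"
  proof -
    have "D_tensor X Y \<mu> \<nu> (\<lambda>p\<in>points (prod_conv X Y). h (f p)) = N.I (\<lambda>y. M.I (\<lambda>x. h (f (x, y))))"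
      if "h \<in> points (cfun Z)" for h :: "'z \<Rightarrow> 'r"
      using restrict_in_cfun[OF convergence_space_prod_conv[OF X Y] hf[OF that]]
      by (simp add: D_tensor_def prod_conv_def cong: restrict_cong)
    then show ?thesis
      by (simp add: D_map_eq cong: restrict_cong)
  qed
  then show "D_integral Z a Y (\<lambda>y. D_integral Z a X (\<lambda>x. f (x, y)) \<mu>) \<nu>
      = D_integral Z a (prod_conv X Y) f (D_tensor X Y \<mu> \<nu>)"
    unfolding iterated_integral[OF a X Y f \<mu> \<nu>] by (simp add: D_integral_def)
  have "N.I (\<lambda>y. M.I (\<lambda>x. h (f (x, y)))) = M.I (\<lambda>x. N.I (\<lambda>y. h (f (x, y))))"
    if "h \<in> points (cfun Z)" for h :: "'z \<Rightarrow> 'r"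
    using functional_Fubini[of "\<lambda>x y. h (f (x, y))"] hf[OF that] by (simp add: case_prod_unfold)
  then have "D_map (prod_conv X Y) Z f (D_tensor X Y \<mu> \<nu>) =
      (\<lambda>h\<in>points (cfun Z). M.I (\<lambda>x. N.I (\<lambda>y. h (f (x, y)))))"
    unfolding tensor by (rule restrict_ext)
  moreover have "D_integral Z a X (\<lambda>x. D_integral Z a Y (\<lambda>y. f (x, y)) \<nu>) \<mu> =
      a (\<lambda>h\<in>points (cfun Z). M.I (\<lambda>x. N.I (\<lambda>y. h (f (x, y)))))"
    using iterated_integral[OF a Y X conv_continuous_prod_swap[OF f] \<nu> \<mu>] by simp
  ultimately show "D_integral Z a (prod_conv X Y) f (D_tensor X Y \<mu> \<nu>)
      = D_integral Z a X (\<lambda>x. D_integral Z a Y (\<lambda>y. f (x, y)) \<nu>) \<mu>"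
    by (simp add: D_integral_def[of Z a "prod_conv X Y"])
qed

theorem corollary8p7p6:
  fixes X :: "'x conv_space" and Y :: "'y conv_space" and Z :: "'z conv_space"
    and f :: "'x \<times> 'y \<Rightarrow> 'z"
  assumes "convergence_space X" and "convergence_space Y"
    and "conv_continuous (prod_conv X Y) Z f"
  shows
    "(\<forall>(a :: (('z \<Rightarrow> real) \<Rightarrow> real) \<Rightarrow> 'z) \<mu> \<nu>.
        D_algebra Z a \<longrightarrow> \<mu> \<in> points (D X) \<longrightarrow> \<nu> \<in> points (D Y) \<longrightarrow>
        D_integral Z a Y (\<lambda>y. D_integral Z a X (\<lambda>x. f (x, y)) \<mu>) \<nu>
          = D_integral Z a (prod_conv X Y) f (D_tensor X Y \<mu> \<nu>) \<and>
        D_integral Z a (prod_conv X Y) f (D_tensor X Y \<mu> \<nu>)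
          = D_integral Z a X (\<lambda>x. D_integral Z a Y (\<lambda>y. f (x, y)) \<nu>) \<mu>) \<and>
     (\<forall>(a :: (('z \<Rightarrow> complex) \<Rightarrow> complex) \<Rightarrow> 'z) \<mu> \<nu>.
        D_algebra Z a \<longrightarrow> \<mu> \<in> points (D X) \<longrightarrow> \<nu> \<in> points (D Y) \<longrightarrow>
        D_integral Z a Y (\<lambda>y. D_integral Z a X (\<lambda>x. f (x, y)) \<mu>) \<nu>
          = D_integral Z a (prod_conv X Y) f (D_tensor X Y \<mu> \<nu>) \<and>
        D_integral Z a (prod_conv X Y) f (D_tensor X Y \<mu> \<nu>)
          = D_integral Z a X (\<lambda>x. D_integral Z a Y (\<lambda>y. f (x, y)) \<nu>) \<mu>)"
  using assms by (auto intro: D_algebra_Fubini)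

end
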